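(* The set of entropies of tree-shifts of finite type is $$\mathcal{E}=\left\{\frac{1}{p}\ln\lambda:\ \lambda\in\mathcal{P},\ p\geq 1\right\},$$ where $\mathcal{P}$ stands for the set of Perron numbers and $p$ ranges over the positive integers.
   Context: Let $\Sigma=\{0,1,\ldots,d-1\}$ and let $\Sigma^{*}=\bigcup_{n\ge 0}\Sigma^n$ be the set of finite words over $\Sigma$ (including the empty word $\epsilon$). Let $\mathcal{A}$ be a finite alphabet. An infinite tree over $\mathcal{A}$ is a function $t:\Sigma^{*}\to\mathcal{A}$; write $t_x=t(x)$. A pattern is a function $u:L\to\mathcal{A}$ on a finite prefix-closed set $L\subset\Sigma^{*}$. The pattern $u$ is a pattern of $t$ if there is $x\in\Sigma^{*}$ with $u_y=t_{xy}$ for all $y\in L$; otherwise $t$ avoids $u$. A block of height $n$ is a pattern with support $\bigcup_{j=0}^{n-1}\Sigma^j$. For a set $\mathcal{F}$ of patterns, $\mathsf{X}_{\mathcal{F}}$ is the set of all infinite trees over $\mathcal{A}$ avoiding every element of $\mathcal{F}$. A tree-shift of finite type is a set of the form $X=\mathsf{X}_{\mathcal{F}}$ with $\mathcal{F}$ finite. $B_n(X)$ denotes the set of all blocks of height $n$ of $X$, i.e. those that are patterns of trees in $X$. The entropy of $X$ is $$h(X)=\lim_{n\to\infty}\frac{\ln\ln|B_n(X)|}{n}$$ whenever the limit exists. A Perron number is a real algebraic integer greater than $1$ and greater than the modulus of its (other) algebraic conjugates.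
   Formalization: Perron numbers are taken to be at least 1 instead of greater than 1, so that 0 belongs to the set: the tree-shift of finite type consisting of the two constant trees over a two-letter alphabet has two blocks of each height n ≥ 1 and hence entropy 0. *)

theory Defs
  imports
    "HOL-Analysis.Analysis"
    "HOL-Computational_Algebra.Computational_Algebra"
    "HOL-Library.FuncSet"
    "HOL-Library.Sublist"
begin

section \<open>Trees and patterns\<close>

definition words :: "nat \<Rightarrow> nat list set"
  where "words d = {w. set w \<subseteq> {..<d}}"

definition trees :: "nat \<Rightarrow> 'a set \<Rightarrow> (nat list \<Rightarrow> 'a) set"
  where "trees d A = words d \<rightarrow>\<^sub>E A"

definition prefix_closed :: "'b list set \<Rightarrow> bool"
  where "prefix_closed L \<longleftrightarrow> (\<forall>w\<in>L. \<forall>v. prefix v w \<longrightarrow> v \<in> L)"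

text \<open>A pattern \<open>u : L \<rightarrow> A\<close> is encoded as a partial map \<open>u\<close> with \<open>dom u = L\<close>.\<close>

definition patterns :: "nat \<Rightarrow> 'a set \<Rightarrow> (nat list \<rightharpoonup> 'a) set"
  where "patterns d A =
    {u. finite (dom u) \<and> dom u \<subseteq> words d \<and> prefix_closed (dom u) \<and> ran u \<subseteq> A}"

definition pattern_of :: "nat \<Rightarrow> (nat list \<rightharpoonup> 'a) \<Rightarrow> (nat list \<Rightarrow> 'a) \<Rightarrow> bool"
  where "pattern_of d u t \<longleftrightarrow> (\<exists>x\<in>words d. \<forall>y\<in>dom u. u y = Some (t (x @ y)))"

definition blocks :: "nat \<Rightarrow> 'a set \<Rightarrow> nat \<Rightarrow> (nat list \<rightharpoonup> 'a) set"
  where "blocks d A n = {u \<in> patterns d A. dom u = (\<Union>j<n. {w \<in> words d. length w = j})}"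

section \<open>Tree-shifts of finite type and their entropy\<close>

definition tree_shift :: "nat \<Rightarrow> 'a set \<Rightarrow> (nat list \<rightharpoonup> 'a) set \<Rightarrow> (nat list \<Rightarrow> 'a) set"
  where "tree_shift d A F = {t \<in> trees d A. \<forall>u\<in>F. \<not> pattern_of d u t}"

definition tree_SFT :: "nat \<Rightarrow> 'a set \<Rightarrow> (nat list \<Rightarrow> 'a) set \<Rightarrow> bool"
  where "tree_SFT d A X \<longleftrightarrow> (\<exists>F. finite F \<and> F \<subseteq> patterns d A \<and> X = tree_shift d A F)"

definition blocks_of :: "nat \<Rightarrow> 'a set \<Rightarrow> nat \<Rightarrow> (nat list \<Rightarrow> 'a) set \<Rightarrow> (nat list \<rightharpoonup> 'a) set"
  where "blocks_of d A n X = {u \<in> blocks d A n. \<exists>t\<in>X. pattern_of d u t}"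

text \<open>
  The first conjunct says that \<open>ln (ln |B_n(X)|)\<close> is mathematically defined for large \<open>n\<close>.
  It is needed because HOL's total \<open>ln\<close> has \<open>ln 0 = 0\<close>, so that a tree-shift which is empty or
  a singleton would otherwise be assigned entropy \<open>0\<close>.
\<close>

definition has_entropy :: "nat \<Rightarrow> 'a set \<Rightarrow> (nat list \<Rightarrow> 'a) set \<Rightarrow> real \<Rightarrow> bool"
  where "has_entropy d A X h \<longleftrightarrow>
    (\<forall>\<^sub>F n in sequentially. 2 \<le> card (blocks_of d A n X)) \<and>
    (\<lambda>n. ln (ln (real (card (blocks_of d A n X)))) / real n) \<longlonglongrightarrow> h"

text \<open>
  The arity \<open>d\<close> and the alphabet range over all possibilities; every finite alphabet is, up to
  renaming, a finite set of natural numbers.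
\<close>

definition tree_SFT_entropies :: "real set"
  where "tree_SFT_entropies =
    {h. \<exists>d\<ge>1. \<exists>A :: nat set. finite A \<and> (\<exists>X. tree_SFT d A X \<and> has_entropy d A X h)}"

section \<open>Perron numbers\<close>

definition is_min_poly :: "rat poly \<Rightarrow> complex \<Rightarrow> bool"
  where "is_min_poly p x \<longleftrightarrow>
    lead_coeff p = 1 \<and> irreducible p \<and> poly (map_poly of_rat p) x = 0"

definition conjugates :: "complex \<Rightarrow> complex set"
  where "conjugates x = {z. \<exists>p. is_min_poly p x \<and> poly (map_poly of_rat p) z = 0}"

text \<open>
  ``Greater than \<open>1\<close>'' is read non-strictly, as in Lind's definition, so that \<open>1\<close> is a Perron
  number. The value \<open>ln 1 = 0\<close> is an entropy: over two letters, the tree-shift consisting of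
  the two constant trees is of finite type and has exactly two blocks of each height \<open>n \<ge> 1\<close>.
\<close>

definition perron :: "real \<Rightarrow> bool"
  where "perron l \<longleftrightarrow> algebraic_int l \<and> 1 \<le> l \<and>
    (\<forall>z \<in> conjugates (complex_of_real l) - {complex_of_real l}. norm z < l)"

end

theory Submission
  imports Defs "HOL-Computational_Algebra.Field_as_Ring" "Jordan_Normal_Form.Char_Poly"
begin

text \<open>
  Let \<open>x n u\<close> be the number of blocks of height \<open>k + n\<close> whose top block of height \<open>k\<close> is \<open>u\<close>.
  For \<open>k\<close> large, \<open>x (n + 1) u = (\<Sum>\<tau>. \<Prod>e<d. x n (\<tau> e))\<close>, where \<open>\<tau>\<close> runs over the possible
  tuples of top blocks of the children, so \<open>y n u = ln (x n u)\<close> obeys the max-plus type recursion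
  \<open>y (n + 1) u = (MAX \<tau>. \<Sum>e<d. y n (\<tau> e)) + O(1)\<close>. If the growth rate \<open>r = exp h\<close> of \<open>y\<close> exceeds
  \<open>1\<close>, the solutions of \<open>s v u = (MAX \<tau>. \<Sum>e<d. v (\<tau> e)) + 1\<close> for \<open>s > r\<close> blow up as \<open>s\<close> tends
  to \<open>r\<close>, and after normalisation they converge to a nonnegative eigenvector with eigenvalue \<open>r\<close>
  of the matrix of one fixed choice \<open>u \<mapsto> \<tau>\<close>. Hence \<open>r\<close> is an eigenvalue of a nonnegative integer
  matrix with a positive eigenvector, and conversely the logarithm of every such \<open>r \<ge> 1\<close> is realised
  by letting the states of a tree evolve deterministically while each state has two copies. Such
  eigenvalues are exactly the roots of Perron numbers: one direction is the description of the peripheral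
  spectrum of a nonnegative matrix, the other one is Lind's theorem, proved by cutting integer
  polynomials with large value at the Perron number into pieces from a finite set.
\<close>

section \<open>Minimal polynomials and integer matrices\<close>

text \<open>Why the solutions blow up: if they stayed bounded as \<open>s\<close> tends to
  \<open>r\<close>, a limit would satisfy the inequality at \<open>r\<close> with a positive
  additive constant. Lowering \<open>r\<close> a little costs only half of that constant, and such a
  supersolution bounds \<open>y\<close> by a smaller exponential rate. So the constant disappears in
  the normalised limit and a genuine eigenvector remains. The matrix obtained in this way need not
  be irreducible. What is available is a nonnegative eigenvector, and deleting the states where it
  vanishes makes it strictly positive. A strictly positive eigenvector already forces its eigenvalue
  to dominate all others in modulus, and passing to the matrix power with exponent
  \<open>fact m\<close> removes other eigenvalues of the same modulus. Hence strictly positive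
  eigenvectors, rather than primitive matrices, link the two sides. The growth rate \<open>1\<close>
  is treated apart, because the lowered rate has to stay above \<open>1\<close>. Nothing is lost,
  since \<open>1\<close> is itself such an eigenvalue.\<close>

interpretation of_rat_poly_hom: map_poly_inj_idom_hom of_rat ..

lemma map_poly_of_rat_of_int:
  "map_poly of_rat (map_poly rat_of_int P) = (map_poly of_int P :: 'a::field_char_0 poly)"
  by (intro poly_eqI) (simp add: coeff_map_poly)

lemma poly_of_rat_dvd_root:
  fixes x :: "'a::field_char_0"
  assumes "p dvd q" "poly (map_poly of_rat p) x = 0"
  shows "poly (map_poly of_rat q) x = 0"
  using assms by (auto elim!: dvdE simp: of_rat_hom.poly_map_poly hom_distribs)

lemma min_poly_dvd:
  assumes p: "is_min_poly p x" and r: "poly (map_poly of_rat r) x = 0"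
  shows "p dvd r"
proof (rule ccontr)
  assume "\<not> p dvd r"
  moreover have "irreducible p" using p by (simp add: is_min_poly_def)
  ultimately have "coprime p r"
    by (intro coprimeI) (meson dvd_trans irreducibleD')
  then have "fst (bezout_coefficients p r) * p + snd (bezout_coefficients p r) * r = 1"
    by (simp add: bezout_coefficients_fst_snd)
  then obtain u v where uv: "u * p + v * r = 1" by blast
  have "poly (map_poly of_rat (u * p + v * r)) x = 0"
    using p r by (simp add: hom_distribs is_min_poly_def)
  then show False unfolding uv by simp
qed

lemma conjugates_min_poly:
  assumes "is_min_poly p x"
  shows "conjugates x = {z. poly (map_poly of_rat p) z = 0}"
proof -
  have "poly (map_poly of_rat p) z = 0" if "is_min_poly q x" "poly (map_poly of_rat q) z = 0" for q z
    using poly_of_rat_dvd_root[OF min_poly_dvd[OF that(1)] that(2), of p] assms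
    by (simp add: is_min_poly_def)
  then show ?thesis using assms by (auto simp: conjugates_def)
qed

lemma ex_min_poly:
  fixes x :: complex
  assumes "P \<noteq> 0" "poly (map_poly of_rat P) x = 0"
  obtains q where "is_min_poly q x"
proof -
  define S where "S q \<longleftrightarrow> lead_coeff q = 1 \<and> poly (map_poly of_rat q) x = 0" for q
  have norm: "S (Polynomial.smult (inverse (lead_coeff r)) r)" if "r \<noteq> 0" "poly (map_poly of_rat r) x = 0" for r
    using that by (simp add: S_def hom_distribs)
  obtain q where q: "S q" and min: "\<And>r. S r \<Longrightarrow> degree q \<le> degree r"
    using norm[OF assms] arg_min_nat_lemma[of S _ degree] by blast
  have le: "degree q \<le> degree r" if "r \<noteq> 0" "poly (map_poly of_rat r) x = 0" for r
    using min[OF norm[OF that]] that by simp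
  have q0: "q \<noteq> 0" using q by (auto simp: S_def)
  have "irreducible q"
  proof (rule irreducibleI)
    show "q \<noteq> 0" by fact
    show "\<not> q dvd 1"
    proof
      assume "q dvd 1"
      then have "poly (map_poly of_rat 1) x = 0" 
        using q poly_of_rat_dvd_root[of q 1 x] by (simp add: S_def)
      then show False by simp
    qed
    fix a b assume ab: "q = a * b"
    then have "a \<noteq> 0" "b \<noteq> 0" using q0 by auto
    then have deg: "degree q = degree a + degree b" using ab by (simp add: degree_mult_eq)
    have "poly (map_poly of_rat a) x = 0 \<or> poly (map_poly of_rat b) x = 0"
      using q by (auto simp: S_def ab hom_distribs)
    then have "degree a = 0 \<or> degree b = 0"
      using le[of a] le[of b] \<open>a \<noteq> 0\<close> \<open>b \<noteq> 0\<close> deg by fastforce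
    then show "a dvd 1 \<or> b dvd 1"
      using \<open>a \<noteq> 0\<close> \<open>b \<noteq> 0\<close> by (auto simp: is_unit_iff_degree)
  qed
  with q have "is_min_poly q x" by (simp add: is_min_poly_def S_def)
  then show ?thesis by (rule that)
qed

lemma rat_poly_clear_denominators:
  "\<exists>d>0. \<exists>Q. Polynomial.smult (rat_of_int d) p = map_poly of_int Q"
proof (induction p)
  case 0
  show ?case by (rule exI[of _ 1]) (auto intro: exI[of _ 0])
next
  case (pCons a p)
  then obtain d Q where d: "d > 0" "Polynomial.smult (rat_of_int d) p = map_poly of_int Q" by blast
  obtain n e where "quotient_of a = (n, e)" by force
  then have e: "e > 0" "a = of_int n / of_int e"
    using quotient_of_denom_pos quotient_of_div by blast+
  have "Polynomial.smult (rat_of_int (d * e)) (pCons a p) = map_poly of_int (pCons (n * d) (Polynomial.smult e Q))"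
    using d e by (simp add: hom_distribs mult.commute flip: d(2))
  then show ?case using d(1) e(1) by (metis mult_pos_pos)
qed

text \<open>Gauss's lemma. Clearing the denominators of \<open>q\<close> and of its cofactor
  \<open>r\<close> gives \<open>A * B\<close>, equal to \<open>a * b\<close> times the primitive
  \<open>P\<close>. The content of \<open>A\<close> divides its leading coefficient
  \<open>a\<close>, that of \<open>B\<close> divides \<open>b\<close>, and the contents multiply to
  \<open>a * b\<close>. So both divisibilities are equalities, and \<open>A\<close> divided by
  \<open>a\<close> is integral.\<close>

lemma monic_rat_factor_int:
  fixes P :: "int poly"
  assumes P: "lead_coeff P = 1" and q: "lead_coeff q = 1" and dvd: "q dvd map_poly rat_of_int P"
  obtains Q where "q = map_poly of_int Q" "lead_coeff Q = 1"
proof -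
  obtain r where qr: "map_poly rat_of_int P = q * r" using dvd by blast
  have "lead_coeff (map_poly rat_of_int P) = 1" using P by simp
  then have r: "lead_coeff r = 1" using q by (simp add: qr lead_coeff_mult)
  obtain a A where a: "a > 0" "Polynomial.smult (rat_of_int a) q = map_poly of_int A"
    using rat_poly_clear_denominators by blast
  obtain b B where b: "b > 0" "Polynomial.smult (rat_of_int b) r = map_poly of_int B"
    using rat_poly_clear_denominators by blast
  have "map_poly rat_of_int (A * B) = map_poly rat_of_int (Polynomial.smult (a * b) P)"
    by (simp add: hom_distribs qr mult.commute flip: a(2) b(2))
  then have AB: "A * B = Polynomial.smult (a * b) P" by (simp only: of_int_poly_hom.eq_iff)
  have "content P dvd 1" using P content_dvd_coeff[of P "degree P"] by simp
  then have "content P = 1" by (metis is_unit_normalize normalize_content)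
  then have "content A * content B = a * b"
    using arg_cong[OF AB, of content] a b by (simp add: content_mult)
  moreover have "lead_coeff A = a" "lead_coeff B = b"
    using arg_cong[OF a(2), of lead_coeff] arg_cong[OF b(2), of lead_coeff] q r a(1) b(1) by simp_all
  then have "content A dvd a" "content B dvd b" by (metis content_dvd_coeff)+
  then have "content A \<le> a" "content B \<le> b" using a b by (auto intro: zdvd_imp_le)
  moreover have "content A \<ge> 0" "content B \<ge> 0"
    by (metis normalize_content abs_ge_zero normalize_int_def)+
  ultimately have "content A = a"
    using mult_less_le_imp_less[of "content A" a "content B" b] a b by force
  then have A: "A = Polynomial.smult a (primitive_part A)" by (metis content_times_primitive_part)
  have "Polynomial.smult (rat_of_int a) q = Polynomial.smult (rat_of_int a) (map_poly of_int (primitive_part A))"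
    using a(2) by (subst (asm) A) (simp add: hom_distribs)
  then have "q = map_poly of_int (primitive_part A)"
    using a(1) by (simp add: poly_eq_iff)
  moreover from this have "lead_coeff (primitive_part A) = 1" using q by simp
  ultimately show ?thesis using that by blast
qed

lemma algebraic_int_min_poly:
  assumes "algebraic_int (l::real)"
  obtains Q :: "int poly" where "lead_coeff Q = 1" "is_min_poly (map_poly of_int Q) (of_real l)"
proof -
  have "algebraic_int (complex_of_real l)" using assms by simp
  then obtain P where P: "poly (map_poly of_int P) (complex_of_real l) = 0" "lead_coeff P = 1"
    unfolding algebraic_int_altdef_ipoly by blast
  then have "map_poly rat_of_int P \<noteq> 0" by auto
  moreover have P': "poly (map_poly of_rat (map_poly rat_of_int P)) (complex_of_real l) = 0"
    using P by (simp add: map_poly_of_rat_of_int)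
  ultimately obtain q where q: "is_min_poly q (of_real l)" by (rule ex_min_poly)
  then have "q dvd map_poly rat_of_int P" "lead_coeff q = 1"
    using P' by (auto intro: min_poly_dvd simp: is_min_poly_def)
  then obtain Q where "q = map_poly of_int Q" "lead_coeff Q = 1"
    using monic_rat_factor_int[OF P(2)] by metis
  then show ?thesis using q that by blast
qed

text \<open>States eigenvectors as functions on the indices below \<open>m\<close>, so that the
  conjugates of an eigenvalue can be tested by plain eigenvector equations.\<close>

lemma eigen_char_poly:
  fixes N :: "nat \<Rightarrow> nat \<Rightarrow> int"
  obtains c :: "int poly" where "lead_coeff c = 1"
    "\<And>z::complex. poly (map_poly of_int c) z = 0 \<longleftrightarrow>
       (\<exists>v. (\<exists>i<m. v i \<noteq> 0) \<and> (\<forall>i<m. (\<Sum>j<m. of_int (N i j) * v j) = z * v i))"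
proof
  define A where "A = mat m m (\<lambda>(i, j). N i j)"
  have A: "A \<in> carrier_mat m m" by (simp add: A_def)
  show "lead_coeff (char_poly A) = 1" using degree_monic_char_poly[OF A] by simp
  fix z :: complex
  let ?C = "map_mat of_int A :: complex mat"
  have C: "?C \<in> carrier_mat m m" using A by simp
  have mul: "(?C *\<^sub>v vec m v) = vec m (\<lambda>i. \<Sum>j<m. of_int (N i j) * v j)" for v
    by (rule eq_vecI) (auto simp: A_def scalar_prod_def atLeast0LessThan)
  have "poly (map_poly of_int (char_poly A)) z = 0 \<longleftrightarrow> eigenvalue ?C z"
    by (simp add: eigenvalue_root_char_poly[OF C] of_int_hom.char_poly_hom[OF A])
  also have "\<dots> \<longleftrightarrow> (\<exists>v. vec m v \<noteq> 0\<^sub>v m \<and> ?C *\<^sub>v vec m v = z \<cdot>\<^sub>v vec m v)"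
  proof
    assume "eigenvalue ?C z"
    then obtain u where u: "u \<in> carrier_vec m" "u \<noteq> 0\<^sub>v m" "?C *\<^sub>v u = z \<cdot>\<^sub>v u"
      unfolding eigenvalue_def eigenvector_def using C by auto
    have "vec m (($) u) = u" using u(1) by (intro eq_vecI) auto
    then show "\<exists>v. vec m v \<noteq> 0\<^sub>v m \<and> ?C *\<^sub>v vec m v = z \<cdot>\<^sub>v vec m v" using u by metis
  next
    assume "\<exists>v. vec m v \<noteq> 0\<^sub>v m \<and> ?C *\<^sub>v vec m v = z \<cdot>\<^sub>v vec m v"
    then show "eigenvalue ?C z" 
      unfolding eigenvalue_def eigenvector_def using C vec_carrier
      by (metis carrier_matD(1))
  qed
  also have "\<dots> \<longleftrightarrow> (\<exists>v. (\<exists>i<m. v i \<noteq> 0) \<and> (\<forall>i<m. (\<Sum>j<m. of_int (N i j) * v j) = z * v i))"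
    unfolding mul by (auto simp: vec_eq_iff)
  finally show "poly (map_poly of_int (char_poly A)) z = 0 \<longleftrightarrow>
       (\<exists>v. (\<exists>i<m. v i \<noteq> 0) \<and> (\<forall>i<m. (\<Sum>j<m. of_int (N i j) * v j) = z * v i))" .
qed

section \<open>Eigenvalues with a positive eigenvector\<close>

definition positive_eigenvalue :: "real \<Rightarrow> bool" where
  "positive_eigenvalue r \<longleftrightarrow> (\<exists>m>0. \<exists>(M :: nat \<Rightarrow> nat \<Rightarrow> nat) w.
     (\<forall>i<m. 0 < w i \<and> (\<Sum>j<m. real (M i j) * w j) = r * w i))"

text \<open>Free index sets matter because the matrices below are indexed by pairs, by integer
  polynomials and by the states of a recursion.\<close>

lemma positive_eigenvalueI:
  fixes w :: "'i \<Rightarrow> real" and M :: "'i \<Rightarrow> 'i \<Rightarrow> nat"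
  assumes "finite I" "I \<noteq> {}" "\<And>i. i \<in> I \<Longrightarrow> 0 < w i"
    and "\<And>i. i \<in> I \<Longrightarrow> (\<Sum>j\<in>I. real (M i j) * w j) = r * w i"
  shows "positive_eigenvalue r"
proof -
  obtain h where h: "bij_betw h {..<card I} I"
    using ex_bij_betw_nat_finite[OF assms(1)] by (auto simp: atLeast0LessThan)
  have "0 < card I" using assms(1,2) by (simp add: card_gt_0_iff)
  moreover have "0 < w (h i) \<and> (\<Sum>j<card I. real (M (h i) (h j)) * w (h j)) = r * w (h i)"
    if "i < card I" for i
  proof -
    have "h i \<in> I" using h that by (auto simp: bij_betw_def)
    then show ?thesis
      using assms(3,4)[of "h i"] sum.reindex_bij_betw[OF h, of "\<lambda>j. real (M (h i) j) * w j"] by simp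
  qed
  ultimately show ?thesis unfolding positive_eigenvalue_def
    by (intro exI[of _ "card I"] conjI exI[of _ "\<lambda>i j. M (h i) (h j)"] exI[of _ "\<lambda>i. w (h i)"]) auto
qed

section \<open>Matrix powers, periodic walks and the peripheral spectrum\<close>

primrec matpow :: "nat \<Rightarrow> (nat \<Rightarrow> nat \<Rightarrow> nat) \<Rightarrow> nat \<Rightarrow> nat \<Rightarrow> nat \<Rightarrow> nat" where
  "matpow m M 0 i j = of_bool (i = j)"
| "matpow m M (Suc n) i j = (\<Sum>k<m. M i k * matpow m M n k j)"

lemma matpow_eigenvector:
  assumes "\<And>i. i < m \<Longrightarrow> (\<Sum>j<m. real (M i j) * w j) = r * w i" "i < m"
  shows "(\<Sum>j<m. real (matpow m M n i j) * w j) = r ^ n * w i"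
  using assms(2)
proof (induction n arbitrary: i)
  case 0
  then show ?case by (simp add: of_bool_def if_distrib[of real] if_distrib[of "\<lambda>x. x * _"] cong: if_cong)
next
  case (Suc n)
  have "(\<Sum>j<m. real (matpow m M (Suc n) i j) * w j)
      = (\<Sum>k<m. real (M i k) * (\<Sum>j<m. real (matpow m M n k j) * w j))"
    by (simp add: sum_distrib_right sum_distrib_left mult.assoc, subst sum.swap, simp)
  also have "\<dots> = (\<Sum>k<m. real (M i k) * (r ^ n * w k))"
    using Suc.IH by simp
  also have "\<dots> = r ^ n * (\<Sum>k<m. real (M i k) * w k)"
    by (simp add: sum_distrib_left mult_ac)
  finally show ?case using assms(1)[OF Suc.prems] by simp
qed

lemma matpow_walk_pos:
  assumes "\<And>i. i < m \<Longrightarrow> f i < m \<and> 0 < M i (f i)" "i < m"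
  shows "0 < matpow m M n i ((f ^^ n) i)"
  using assms(2)
proof (induction n arbitrary: i)
  case (Suc n)
  have "0 < M i (f i) * matpow m M n (f i) ((f ^^ n) (f i))"
    using Suc.IH[of "f i"] assms(1) Suc.prems by simp
  also have "\<dots> \<le> (\<Sum>k<m. M i k * matpow m M n k ((f ^^ n) (f i)))"
    using assms(1)[OF Suc.prems] by (intro member_le_sum) auto
  finally show ?case by (simp add: funpow_swap1)
qed simp

text \<open>Two of the iterates up to time \<open>m\<close> coincide, so from some time at most
  \<open>m\<close> on the orbit has a period at most \<open>m\<close>, which divides
  \<open>fact m\<close>. The starting time is a multiple of \<open>fact m\<close>, so that iterating
  the \<open>fact m\<close>-step map reaches it.\<close>

lemma funpow_fact_periodic:
  fixes f :: "nat \<Rightarrow> nat"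
  assumes "\<And>i. i < m \<Longrightarrow> f i < m" "i < m"
  shows "(f ^^ (fact m * m + fact m)) i = (f ^^ (fact m * m)) i"
proof -
  let ?g = "\<lambda>n. (f ^^ n) i"
  have g: "?g n < m" for n using assms by (induction n) auto
  have "\<not> inj_on ?g {..m}"
  proof
    assume "inj_on ?g {..m}"
    then have "card {..m} \<le> card {..<m}" by (rule card_inj_on_le) (use g in auto)
    then show False by simp
  qed
  then obtain a' b' where "a' \<le> m" "b' \<le> m" "?g a' = ?g b'" "a' \<noteq> b'"
    unfolding inj_on_def by blast
  then have "min a' b' < max a' b' \<and> max a' b' \<le> m \<and> ?g (min a' b') = ?g (max a' b')"
    by (simp add: min_def max_def)
  then obtain a b where ab: "a < b" "b \<le> m" "?g a = ?g b" by blast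
  have 1: "?g (n + (b - a)) = ?g n" if "a \<le> n" for n
  proof -
    define k where "k = n - a"
    have k: "n = k + a" using that by (simp add: k_def)
    have "n + (b - a) = k + b" using k ab(1) by simp
    then have "?g (n + (b - a)) = (f ^^ k) (?g b)" by (simp add: funpow_add)
    also have "\<dots> = ?g n" unfolding k ab(3)[symmetric] by (simp add: funpow_add)
    finally show ?thesis .
  qed
  have 2: "?g (n + q * (b - a)) = ?g n" if "a \<le> n" for n q
  proof (induction q)
    case (Suc q)
    then show ?case using 1[of "n + q * (b - a)"] that by (simp add: ac_simps)
  qed simp
  have "(b - a) dvd fact m" using ab by (intro dvd_fact) auto
  then obtain q where "fact m = (b - a) * q" by (rule dvdE)
  then have q: "fact m * m + q * (b - a) = fact m * m + fact m"
    by (simp only: mult.commute[of q])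
  have "1 * m \<le> fact m * m" by (intro mult_le_mono1 fact_ge_1)
  then have "a \<le> fact m * m" using ab by linarith
  from 2[OF this, of q] show ?thesis unfolding q .
qed

text \<open>
  An eigenvector \<open>v\<close> of \<open>N\<close> with \<open>\<bar>z\<bar> = l\<close> is compared with the positive one \<open>w\<close>: where
  \<open>\<bar>v i\<bar> / w i\<close> is maximal, equality holds in the triangle inequality, which fixes the phases.
\<close>

lemma peripheral_eigenvector:
  fixes v :: "nat \<Rightarrow> complex" and N :: "nat \<Rightarrow> nat \<Rightarrow> nat"
  assumes w: "\<And>i. i < m \<Longrightarrow> 0 < w i" and Nw: "(\<Sum>j<m. real (N i j) * w j) = l * w i"
    and Nv: "(\<Sum>j<m. of_nat (N i j) * v j) = z * v i" and z: "norm z = l" and l: "l > 0"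
    and s: "\<And>j. j < m \<Longrightarrow> norm (v j) \<le> s * w j" "norm (v i) = s * w i" "s > 0"
    and i: "i < m" and j: "j < m" "0 < N i j"
  shows "norm (v j) = s * w j" "j = i \<Longrightarrow> z = of_real l"
proof -
  \<comment> \<open>Multiplication by \<open>t\<close> rotates \<open>z * v i\<close> onto the
    positive real axis.\<close>
  define t where "t = cnj (sgn (z * v i))"
  have "norm (v i) > 0" using s(2,3) w[OF i] by simp
  then have nz: "z * v i \<noteq> 0" using z l by auto
  then have t: "norm t = 1" by (simp add: t_def norm_sgn)
  have tv: "t * (z * v i) = of_real (norm (z * v i))"
  proof -
    have "cnj (z * v i) * (z * v i) = of_real (norm (z * v i)) * of_real (norm (z * v i))"
      using complex_norm_square[of "z * v i"] by (simp only: power2_eq_square mult.commute of_real_mult)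
    then show ?thesis using nz unfolding t_def sgn_eq complex_cnj_divide complex_cnj_complex_of_real
      by (simp add: divide_simps)
  qed
  define R where "R k = Re (t * v k)" for k
  have le: "R k \<le> s * w k" if "k < m" for k
  proof -
    have "R k \<le> norm (t * v k)" unfolding R_def by (rule complex_Re_le_cmod)
    then show ?thesis using t s(1)[OF that] by (simp add: norm_mult)
  qed
  have "t * (\<Sum>k<m. of_nat (N i k) * v k) = (\<Sum>k<m. of_real (real (N i k)) * (t * v k))"
    by (simp add: sum_distrib_left mult_ac)
  then have "Re (t * (\<Sum>k<m. of_nat (N i k) * v k)) = (\<Sum>k<m. real (N i k) * R k)"
    by (simp add: R_def)
  \<comment> \<open>The nonnegative deficits \<open>s * w k - R k\<close>, weighted with row
    \<open>i\<close>, add up to zero, so each one with a positive entry vanishes.\<close>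
  then have "(\<Sum>k<m. real (N i k) * (s * w k - R k))
      = s * (\<Sum>k<m. real (N i k) * w k) - Re (t * (\<Sum>k<m. of_nat (N i k) * v k))"
    by (simp only: sum_subtractf right_diff_distrib sum_distrib_left mult.left_commute)
  also have "\<dots> = 0"
    unfolding Nw Nv tv using s(2) z by (simp add: norm_mult algebra_simps)
  finally have "\<forall>k\<in>{..<m}. real (N i k) * (s * w k - R k) = 0"
    by (subst (asm) sum_nonneg_eq_0_iff) (auto simp: le)
  then have "real (N i j) * (s * w j - R j) = 0" using j(1) by blast
  then have "R j = s * w j" using j(2) by simp
  then have Re: "Re (t * v j) = s * w j" by (simp add: R_def)
  have "norm (t * v j) \<le> s * w j" using s(1)[OF j(1)] t by (simp add: norm_mult)
  then have nj: "norm (t * v j) = s * w j" using Re complex_Re_le_cmod[of "t * v j"] by linarith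
  then show "norm (v j) = s * w j" using t by (simp add: norm_mult)
  have "Im (t * v j) = 0" using cmod_power2[of "t * v j"] unfolding Re nj by simp
  then have tvj: "t * v j = of_real (s * w j)" using Re by (simp add: complex_eq_iff)
  \<comment> \<open>A positive diagonal entry compares \<open>v i\<close> with
    \<open>z * v i\<close>: the same rotation makes both positive, so \<open>z\<close> is
    positive.\<close>
  show "z = of_real l" if "j = i"
  proof -
    have "z * (t * v i) = of_real (norm (z * v i))" using tv by (simp add: mult_ac)
    also have "\<dots> = of_real l * (t * v i)"
      using tvj that by (simp add: norm_mult s(2) z)
    finally have "z * (t * v i) = of_real l * (t * v i)" .
    moreover have "t * v i \<noteq> 0" using nz t by auto
    ultimately show ?thesis by simp
  qed
qed

text \<open>Conjugates of \<open>l = r ^ p\<close> are roots of the characteristic polynomial of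
  \<open>N\<close>, the \<open>p\<close>-th power of \<open>M\<close>, so they have eigenvectors to
  compare with \<open>w\<close>. If one had modulus \<open>l\<close>, the maximal ratio
  \<open>norm (v i) / w i\<close> would propagate along positive entries of \<open>N\<close> to a
  state with a positive diagonal entry, where the phase of \<open>z\<close> must be trivial. The
  exponent \<open>p = fact m\<close> guarantees that some walk reaches such a state.\<close>

lemma positive_eigenvalue_imp_perron:
  assumes "positive_eigenvalue r" "r \<ge> 1"
  shows "\<exists>p\<ge>1. perron (r ^ p)"
proof -
  from assms(1) obtain m :: nat and M w where m: "m > 0"
    and w: "\<And>i. i < m \<Longrightarrow> 0 < w i"
    and Mw: "\<And>i. i < m \<Longrightarrow> (\<Sum>j<m. real (M i j) * w j) = r * w i"
    unfolding positive_eigenvalue_def by blast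
  define p :: nat where "p = fact m"
  define N where "N = matpow m M p"
  define l where "l = r ^ p"
  have l: "l \<ge> 1" using assms(2) by (simp add: l_def)
  have Nw: "(\<Sum>j<m. real (N i j) * w j) = l * w i" if "i < m" for i
    unfolding N_def l_def using matpow_eigenvector[OF Mw that] .
  obtain c where c: "lead_coeff c = 1"
    "\<And>z::complex. poly (map_poly of_int c) z = 0 \<longleftrightarrow>
       (\<exists>v. (\<exists>i<m. v i \<noteq> 0) \<and> (\<forall>i<m. (\<Sum>j<m. of_int (int (N i j)) * v j) = z * v i))"
    using eigen_char_poly[of m "\<lambda>i j. int (N i j)"] by blast
  have w0: "\<exists>i<m. w i \<noteq> 0" using m w by (metis less_irrefl)
  have "(\<Sum>j<m. of_nat (N i j) * complex_of_real (w j)) = of_real l * of_real (w i)" if "i < m" for i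
    using arg_cong[OF Nw[OF that], of complex_of_real] by simp
  then have cl: "poly (map_poly of_int c) (complex_of_real l) = 0"
    using c(2) w0 by (auto intro!: exI[of _ "\<lambda>i. complex_of_real (w i)"])
  then have alg: "algebraic_int (complex_of_real l)"
    unfolding algebraic_int_altdef_ipoly using c(1) by blast
  have "map_poly rat_of_int c \<noteq> 0" using c(1) by auto
  moreover have "poly (map_poly of_rat (map_poly rat_of_int c)) (complex_of_real l) = 0"
    using cl by (simp only: map_poly_of_rat_of_int)
  ultimately obtain q where q: "is_min_poly q (complex_of_real l)" by (rule ex_min_poly)
  have "norm z < l" if z: "z \<in> conjugates (of_real l)" "z \<noteq> of_real l" for z
  proof -
    have "poly (map_poly of_rat q) z = 0" using z(1) by (simp add: conjugates_min_poly[OF q])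
    then have "poly (map_poly of_int c) z = 0"
      using poly_of_rat_dvd_root[of q "map_poly of_int c" z] min_poly_dvd[OF q, of "map_poly of_int c"] cl
      by (simp add: map_poly_of_rat_of_int)
    then obtain v where v0: "\<exists>i<m. v i \<noteq> 0"
      and v: "\<And>i. i < m \<Longrightarrow> (\<Sum>j<m. of_nat (N i j) * v j) = z * v i"
      using c(2) by auto
    define s where "s = Max ((\<lambda>i. norm (v i) / w i) ` {..<m})"
    have s: "norm (v i) \<le> s * w i" if "i < m" for i
    proof -
      have "norm (v i) / w i \<le> s" unfolding s_def using that by (intro Max_ge) auto
      then show ?thesis using w[OF that] by (simp add: pos_divide_le_eq)
    qed
    have "s \<in> (\<lambda>i. norm (v i) / w i) ` {..<m}"
      unfolding s_def using m by (intro Max_in) auto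
    then obtain i0 where "i0 < m" "s = norm (v i0) / w i0" by blast
    then have i0: "i0 < m" "norm (v i0) = s * w i0" using w[of i0] by auto
    obtain k where k: "k < m" "v k \<noteq> 0" using v0 by blast
    have "0 < s * w k" using s[OF k(1)] k(2) by (meson less_le_trans zero_less_norm_iff)
    then have s0: "s > 0" using w[OF k(1)] by (simp add: zero_less_mult_iff)
    have "norm z * (s * w i0) = norm (\<Sum>j<m. of_nat (N i0 j) * v j)"
      using v[OF i0(1)] i0(2) by (simp add: norm_mult)
    also have "\<dots> \<le> (\<Sum>j<m. real (N i0 j) * (s * w j))"
      by (rule sum_norm_le) (auto simp: norm_mult intro!: mult_left_mono s)
    also have "\<dots> = s * (\<Sum>j<m. real (N i0 j) * w j)" by (simp add: sum_distrib_left mult_ac)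
    also have "\<dots> = l * (s * w i0)" using Nw[OF i0(1)] by simp
    finally have "norm z \<le> l" using s0 w[OF i0(1)] by simp
    moreover have "norm z \<noteq> l"
    proof
      assume nz: "norm z = l"
      have lpos: "l > 0" using l by simp
      have per: "norm (v j) = s * w j" "j = i \<Longrightarrow> z = of_real l"
        if "i < m" "j < m" "0 < N i j" "norm (v i) = s * w i" for i j
        using peripheral_eigenvector[of m w N i l v z s j,
            OF w Nw[OF that(1)] v[OF that(1)] nz lpos s that(4) s0 that(1-3)] by simp_all
      \<comment> \<open>Each row has a positive entry because \<open>r * w i > 0\<close>;
        \<open>f\<close> selects one, and following \<open>f\<close> gives a walk.\<close>
      have "\<exists>j<m. 0 < M i j" if "i < m" for i
      proof (rule ccontr)
        assume "\<not> ?thesis"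
        then have "r * w i = 0" using Mw[OF that] by simp
        then show False using assms(2) w[OF that] by simp
      qed
      then obtain f where f: "\<And>i. i < m \<Longrightarrow> f i < m \<and> 0 < M i (f i)" by metis
      have fn: "(f ^^ n) i < m" if "i < m" for i n using f that by (induction n) auto
      have step: "0 < N i ((f ^^ p) i)" if "i < m" for i
        unfolding N_def using matpow_walk_pos[of m f M i p] f that by blast
      have walk: "norm (v ((f ^^ (p * n)) i0)) = s * w ((f ^^ (p * n)) i0)" for n
      proof (induction n)
        case (Suc n)
        have "(f ^^ (p * Suc n)) i0 = (f ^^ p) ((f ^^ (p * n)) i0)"
          by (simp add: funpow_add)
        then have "0 < N ((f ^^ (p * n)) i0) ((f ^^ (p * Suc n)) i0)"
          using step[OF fn[OF i0(1)]] by (simp only:)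
        from per(1)[OF fn[OF i0(1)] fn[OF i0(1)] this Suc] show ?case .
      qed (use i0 in simp)
      define i where "i = (f ^^ (p * m)) i0"
      have im: "i < m" using fn[OF i0(1)] by (simp add: i_def)
      have "(f ^^ (p * m + p)) i0 = i"
        unfolding i_def p_def using funpow_fact_periodic[of m f i0] f i0(1) by blast
      moreover have "(f ^^ (p + p * m)) i0 = (f ^^ p) i"
        unfolding i_def funpow_add by simp
      ultimately have "(f ^^ p) i = i" by (simp only: add.commute)
      then have "0 < N i i" using step[OF im] by simp
      then have "z = of_real l" using per(2)[of i i] im walk l by (simp add: i_def)
      then show False using z(2) by simp
    qed
    ultimately show ?thesis by simp
  qed
  then have "perron l" using alg l by (auto simp: perron_def)
  moreover have "1 \<le> p" unfolding p_def by (rule fact_ge_1)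
  ultimately show ?thesis unfolding l_def by blast
qed

text \<open>Take \<open>p\<close> copies of the index set, pass unchanged from each copy to the next
  and apply \<open>M\<close> on the way from the last to the first. A full round multiplies by
  \<open>l\<close>; with weight \<open>r ^ e\<close> on copy \<open>e\<close>, every single step
  multiplies by \<open>r\<close>.\<close>

lemma positive_eigenvalue_root:
  assumes "positive_eigenvalue l" "l > 0" "p \<ge> 1" "r > 0" "r ^ p = l"
  shows "positive_eigenvalue r"
proof -
  from assms(1) obtain m :: nat and M w where m: "m > 0"
    and w: "\<And>i. i < m \<Longrightarrow> 0 < w i"
    and Mw: "\<And>i. i < m \<Longrightarrow> (\<Sum>j<m. real (M i j) * w j) = l * w i"
    unfolding positive_eigenvalue_def by blast
  define K where "K x y = (if Suc (snd x) < p then of_bool (fst y = fst x \<and> snd y = Suc (snd x))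
     else of_bool (snd y = 0) * M (fst x) (fst y))" for x y
  have "(\<Sum>y\<in>{..<m} \<times> {..<p}. real (K x y) * (w (fst y) * r ^ snd y)) = r * (w (fst x) * r ^ snd x)"
    if "x \<in> {..<m} \<times> {..<p}" for x
  proof (cases "Suc (snd x) < p")
    case True
    then have "K x y = (if y = (fst x, Suc (snd x)) then 1 else 0)" for y
      by (simp add: K_def prod_eq_iff)
    then have "real (K x y) * (w (fst y) * r ^ snd y)
        = (if y = (fst x, Suc (snd x)) then w (fst y) * r ^ snd y else 0)" for y
      by simp
    moreover have "(fst x, Suc (snd x)) \<in> {..<m} \<times> {..<p}" using that True by auto
    ultimately show ?thesis by simp
  next
    case False
    then have x: "Suc (snd x) = p" "fst x < m" using that by auto
    have K: "K x (j, e) = (if e = 0 then M (fst x) j else 0)" for j e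
      using False by (simp add: K_def)
    have "(\<Sum>y\<in>{..<m} \<times> {..<p}. real (K x y) * (w (fst y) * r ^ snd y))
        = (\<Sum>j<m. \<Sum>e<p. real (K x (j, e)) * (w j * r ^ e))"
      by (simp add: sum.cartesian_product case_prod_beta)
    also have "\<dots> = (\<Sum>j<m. \<Sum>e<p. if e = 0 then real (M (fst x) j) * w j else 0)"
      by (intro sum.cong refl) (simp add: K)
    also have "\<dots> = (\<Sum>j<m. real (M (fst x) j) * w j)"
      using assms(3) by simp
    also have "\<dots> = r ^ Suc (snd x) * w (fst x)"
      using Mw[OF x(2)] by (simp only: x(1) assms(5))
    also have "\<dots> = r * (w (fst x) * r ^ snd x)" by simp
    finally show ?thesis .
  qed
  moreover have "0 < w (fst y) * r ^ snd y" if "y \<in> {..<m} \<times> {..<p}" for y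
    using that w assms(4) by auto
  moreover have "finite ({..<m} \<times> {..<p})" "{..<m} \<times> {..<p} \<noteq> {}"
    using m assms(3) by (auto simp: lessThan_empty_iff)
  ultimately show ?thesis
    using positive_eigenvalueI[of "{..<m} \<times> {..<p}" "\<lambda>y. w (fst y) * r ^ snd y" K r] by blast
qed

section \<open>Perron numbers are such eigenvalues\<close>

text \<open>Reads a sum over successors as a matrix row whose entries are the multiplicities of the
  successors. Allowing successors of weight zero outside \<open>B\<close> makes it possible to keep
  only the support of an eigenvector.\<close>

lemma sum_card_fibres:
  fixes w :: "'b \<Rightarrow> real"
  assumes "finite A" "finite B" "\<And>a. a \<in> A \<Longrightarrow> g a \<notin> B \<Longrightarrow> w (g a) = 0"
  shows "(\<Sum>b\<in>B. real (card {a \<in> A. g a = b}) * w b) = (\<Sum>a\<in>A. w (g a))"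
proof -
  have "(\<Sum>b\<in>B. real (card {a \<in> A. g a = b}) * w b) = (\<Sum>b\<in>B. \<Sum>a | a \<in> {a \<in> A. g a \<in> B} \<and> g a = b. w (g a))"
  proof (rule sum.cong[OF refl])
    fix b assume b: "b \<in> B"
    have "(\<Sum>a | a \<in> {a \<in> A. g a \<in> B} \<and> g a = b. w (g a)) = (\<Sum>a\<in>{a \<in> A. g a = b}. w b)"
      using b by (intro sum.cong) auto
    then show "real (card {a \<in> A. g a = b}) * w b = (\<Sum>a | a \<in> {a \<in> A. g a \<in> B} \<and> g a = b. w (g a))"
      by (simp only: sum_constant)
  qed
  also have "\<dots> = (\<Sum>a | a \<in> A \<and> g a \<in> B. w (g a))"
    using assms(1,2) by (intro sum.group) auto
  also have "\<dots> = (\<Sum>a\<in>A. w (g a))"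
    using assms by (intro sum.mono_neutral_left) auto
  finally show ?thesis .
qed

section \<open>Integer polynomials: interpolation bounds and rounding\<close>

lemma poly_eq_sum_lessThan:
  fixes p :: "'a::comm_semiring_1 poly"
  assumes "degree p < n"
  shows "poly p x = (\<Sum>k<n. coeff p k * x ^ k)"
  unfolding poly_altdef using assms
  by (intro sum.mono_neutral_left) (auto simp: coeff_eq_0)

text \<open>A polynomial of degree below the number of points is its own Lagrange interpolant, so
  bounded values on \<open>Z\<close> bound each coefficient uniformly in \<open>f\<close>.\<close>

lemma lagrange_coeff_bound:
  fixes Z :: "complex set"
  assumes "finite Z"
  shows "\<exists>B. \<forall>f. degree f < card Z \<longrightarrow> (\<forall>z\<in>Z. norm (poly f z) \<le> R) \<longrightarrow> (\<forall>k. norm (coeff f k) \<le> B k)"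
proof (intro exI allI impI)
  fix f :: "complex poly" and k
  assume deg: "degree f < card Z" and R: "\<forall>z\<in>Z. norm (poly f z) \<le> R"
  define P where "P z = (\<Prod>y\<in>Z - {z}. [:-y, 1:])" for z
  define L where "L z = Polynomial.smult (inverse (poly (P z) z)) (P z)" for z
  define h where "h = (\<Sum>z\<in>Z. Polynomial.smult (poly f z) (L z))"
  have P: "poly (P z) y = (\<Prod>x\<in>Z - {z}. y - x)" for z y by (simp add: P_def poly_prod)
  have L: "poly (L z) y = of_bool (y = z)" if "y \<in> Z" "z \<in> Z" for y z
    using that assms by (auto simp: L_def P prod_zero_iff)
  have degP: "degree (P z) < card Z" if "z \<in> Z" for z
  proof -
    have "degree (P z) \<le> (\<Sum>y\<in>Z - {z}. degree [:-y, 1:])"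
      unfolding P_def using degree_prod_sum_le[of "Z - {z}" "\<lambda>y. [:-y, 1:]"] assms by (simp add: comp_def)
    then show ?thesis using that assms card_gt_0_iff[of Z] by (auto simp: card_Diff_singleton)
  qed
  have "degree h < card Z"
    unfolding h_def using deg degP
    by (intro degree_sum_less) (auto simp: L_def intro: le_less_trans[OF degree_smult_le] order.strict_trans1)
  then have d: "degree (f - h) < card Z" using deg by (simp add: degree_diff_less)
  have "poly h y = poly f y" if "y \<in> Z" for y
  proof -
    have "poly h y = (\<Sum>z\<in>Z. if y = z then poly f z else 0)"
      unfolding h_def poly_sum using that by (intro sum.cong) (auto simp: L)
    then show ?thesis using that assms by simp
  qed
  then have Z: "Z \<subseteq> {x. poly (f - h) x = 0}" by auto
  have "f - h = 0"
  proof (rule ccontr)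
    assume nz: "f - h \<noteq> 0"
    then have "card Z \<le> card {x. poly (f - h) x = 0}"
      by (intro card_mono poly_roots_finite Z)
    also have "\<dots> \<le> degree (f - h)" using nz by (rule card_poly_roots_bound)
    finally show False using d by simp
  qed
  then have "coeff f k = coeff h k" by simp
  also have "\<dots> = (\<Sum>z\<in>Z. poly f z * coeff (L z) k)" by (simp add: h_def coeff_sum)
  finally have "coeff f k = (\<Sum>z\<in>Z. poly f z * coeff (L z) k)" .
  then have "norm (coeff f k) \<le> (\<Sum>z\<in>Z. norm (poly f z * coeff (L z) k))"
    by (simp add: norm_sum)
  also have "\<dots> \<le> (\<Sum>z\<in>Z. R * norm (coeff (L z) k))"
    using R by (intro sum_mono) (auto simp: norm_mult intro!: mult_right_mono)
  \<comment> \<open>The bound is chosen before \<open>f\<close>, so it is written in terms of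
    \<open>Z\<close> and \<open>R\<close> alone, with the interpolation basis expanded.\<close>
  finally show "norm (coeff f k) \<le> (\<Sum>z\<in>Z. R * norm (coeff
      (Polynomial.smult (inverse (poly (\<Prod>y\<in>Z - {z}. [:-y, 1:]) z)) (\<Prod>y\<in>Z - {z}. [:-y, 1:])) k))"
    by (simp add: L_def P_def)
qed

lemma finite_int_poly_bounded_coeffs:
  fixes B :: "nat \<Rightarrow> real"
  shows "finite {f :: int poly. degree f < n \<and> (\<forall>k. \<bar>of_int (coeff f k)\<bar> \<le> B k)}" (is "finite ?S")
proof (rule inj_on_finite)
  show "inj_on (\<lambda>f. restrict (coeff f) {..<n}) ?S"
  proof (rule inj_onI)
    fix f g assume fg: "f \<in> ?S" "g \<in> ?S" "restrict (coeff f) {..<n} = restrict (coeff g) {..<n}"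
    show "f = g"
    proof (rule poly_eqI)
      fix k show "coeff f k = coeff g k"
      proof (cases "k < n")
        case True
        have "restrict (coeff f) {..<n} k = restrict (coeff g) {..<n} k" by (simp only: fg(3))
        then show ?thesis using True by simp
      qed (use fg in \<open>simp add: coeff_eq_0\<close>)
    qed
  qed
  show "(\<lambda>f. restrict (coeff f) {..<n}) ` ?S \<subseteq> (\<Pi>\<^sub>E k\<in>{..<n}. {-\<lceil>B k\<rceil>..\<lceil>B k\<rceil>})"
  proof (clarsimp simp: image_subset_iff PiE_iff)
    fix f k assume "\<forall>k. \<bar>real_of_int (coeff f k)\<bar> \<le> B k"
    then have "\<bar>real_of_int (coeff f k)\<bar> \<le> B k" by blast
    then show "- \<lceil>B k\<rceil> \<le> coeff f k \<and> coeff f k \<le> \<lceil>B k\<rceil>" by linarith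
  qed
  show "finite (\<Pi>\<^sub>E k\<in>{..<n}. {-\<lceil>B k\<rceil>..\<lceil>B k\<rceil>})" by (intro finite_PiE) auto
qed

text \<open>
  The \<open>j\<close>-th of \<open>N\<close> nearly equal integral pieces of \<open>g\<close>, obtained by rounding the coefficients of
  \<open>(j + 1) g / N\<close> and of \<open>j g / N\<close>, so that the pieces telescope to \<open>g\<close>.
\<close>

definition poly_piece :: "nat \<Rightarrow> int poly \<Rightarrow> nat \<Rightarrow> int poly" where
  "poly_piece N g j = map_poly (\<lambda>a. (int (Suc j) * a) div int N - (int j * a) div int N) g"

lemma coeff_poly_piece:
  "coeff (poly_piece N g j) k = (int (Suc j) * coeff g k) div int N - (int j * coeff g k) div int N"
  unfolding poly_piece_def by (rule coeff_map_poly) simp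

lemma sum_poly_piece:
  assumes "N > 0"
  shows "(\<Sum>j<N. poly_piece N g j) = g"
proof (rule poly_eqI)
  fix k
  have "coeff (\<Sum>j<N. poly_piece N g j) k = (int N * coeff g k) div int N - (int 0 * coeff g k) div int N"
    unfolding coeff_sum coeff_poly_piece
    by (rule sum_lessThan_telescope[of "\<lambda>j. (int j * coeff g k) div int N"])
  then show "coeff (\<Sum>j<N. poly_piece N g j) k = coeff g k" using assms by simp
qed

lemma coeff_poly_piece_near:
  assumes "N > 0"
  shows "\<bar>real_of_int (coeff (poly_piece N g j) k) - real_of_int (coeff g k) / real N\<bar> \<le> 1"
proof -
  define a where "a = coeff g k"
  have "real_of_int ((int i * a) div int N) = of_int \<lfloor>real i * of_int a / real N\<rfloor>" for i
    using floor_divide_of_int_eq[of "int i * a" "int N", where 'a = real] by simp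
  moreover have "real (Suc j) * of_int a / real N = real j * of_int a / real N + of_int a / real N"
    by (simp add: add_divide_distrib distrib_right)
  ultimately show ?thesis unfolding coeff_poly_piece a_def[symmetric] by (simp del: of_nat_Suc) linarith
qed

text \<open>Rounding costs at most \<open>1\<close> per coefficient. The bound is uniform on the
  disc of radius \<open>l\<close>, so it serves \<open>l\<close> and its dominated conjugates at
  once.\<close>

lemma poly_poly_piece_near:
  fixes x :: "'a::{real_normed_field}"
  assumes "N > 0" "degree g < n" "norm x \<le> l"
  shows "norm (poly (map_poly of_int (poly_piece N g j)) x - poly (map_poly of_int g) x / of_nat N) \<le> (\<Sum>k<n. l ^ k)"
proof -
  let ?c = "\<lambda>k. real_of_int (coeff (poly_piece N g j) k) - real_of_int (coeff g k) / real N"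
  have "degree (poly_piece N g j) < n"
    using assms(2) degree_map_poly_le le_less_trans unfolding poly_piece_def by blast
  then have "poly (map_poly of_int (poly_piece N g j)) x - poly (map_poly of_int g) x / of_nat N
      = (\<Sum>k<n. of_real (?c k) * x ^ k)"
    using assms(2)
    by (simp add: poly_eq_sum_lessThan[of _ n] coeff_map_poly sum_divide_distrib
        sum_subtractf[symmetric] left_diff_distrib)
  also have "norm \<dots> \<le> (\<Sum>k<n. l ^ k)"
  proof (rule sum_norm_le)
    fix k
    have "\<bar>?c k\<bar> * norm x ^ k \<le> 1 * l ^ k"
      using coeff_poly_piece_near[OF assms(1)] assms(3) by (intro mult_mono power_mono) auto
    then show "norm (of_real (?c k) * x ^ k) \<le> l ^ k"
      by (simp only: norm_mult norm_power norm_of_real mult_1)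
  qed
  finally show ?thesis .
qed

lemma poly_of_int_of_real:
  "poly (map_poly of_int f) (complex_of_real x) = of_real (poly (map_poly of_int f) x)"
  by (induction f) (simp_all add: hom_distribs)

text \<open>A common root with the derivative would have the same minimal polynomial, which would
  then divide the derivative of smaller degree. Having \<open>degree Q\<close> distinct roots lets
  interpolation on them determine polynomials of lower degree.\<close>

lemma card_roots_min_poly:
  assumes "is_min_poly (map_poly of_int Q) x"
  shows "card {z::complex. poly (map_poly of_int Q) z = 0} = degree Q" "degree Q > 0"
proof -
  let ?q = "map_poly rat_of_int Q" and ?Q = "map_poly of_int Q :: complex poly"
  have irr: "irreducible ?q" using assms by (simp add: is_min_poly_def)
  show deg: "degree Q > 0"
  proof (rule ccontr)
    assume "\<not> degree Q > 0"
    then have "is_unit ?q" using irr by (auto simp: is_unit_iff_degree)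
    then show False using irr by (simp add: irreducible_def)
  qed
  have "rsquarefree ?Q"
    unfolding rsquarefree_roots
  proof (intro allI notI)
    fix a assume a: "poly ?Q a = 0 \<and> poly (pderiv ?Q) a = 0"
    have "is_min_poly ?q a" using assms a by (simp add: is_min_poly_def map_poly_of_rat_of_int)
    moreover have "poly (map_poly of_rat (pderiv ?q)) a = 0"
      using a by (simp add: map_poly_of_rat_of_int of_rat_hom.map_poly_pderiv)
    ultimately have "?q dvd pderiv ?q" by (rule min_poly_dvd)
    moreover have "pderiv ?q \<noteq> 0" using deg by (simp add: pderiv_eq_0_iff)
    ultimately have "degree ?q \<le> degree (pderiv ?q)" by (rule dvd_imp_degree_le)
    then show False using deg by (simp add: degree_pderiv)
  qed
  then have "degree ?Q = degree (Polynomial.smult (lead_coeff ?Q) (\<Prod>z | poly ?Q z = 0. [:-z, 1:]))"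
    by (subst complex_poly_decompose_rsquarefree) auto
  also have "\<dots> = degree (\<Prod>z | poly ?Q z = 0. [:-z, 1:])"
    using deg by (subst degree_smult_eq) auto
  also have "\<dots> = card {z. poly ?Q z = 0}" by (subst degree_prod_eq_sum_degree) auto
  finally show "card {z::complex. poly (map_poly of_int Q) z = 0} = degree Q" by simp
qed

text \<open>Polynomials of degree below \<open>n\<close> stand for elements of the ring generated by
  \<open>l\<close>. The set \<open>\<Omega>\<close> collects those that are positive and bounded at
  \<open>l\<close> and dominate their values at the conjugates; interpolation makes it finite.
  Multiplication by \<open>l\<close> shrinks the conjugate values relative to the value at
  \<open>l\<close> by \<open>\<mu> / l\<close>, and this gap pays for the rounding when a product
  too large for \<open>\<Omega>\<close> is split. The multiplicities of the pieces form a matrix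
  row, and the values \<open>F\<close> are the eigenvector.\<close>

lemma perron_imp_positive_eigenvalue:
  assumes "perron l"
  shows "positive_eigenvalue l"
proof -
  have alg: "algebraic_int l" and l1: "1 \<le> l" using assms by (auto simp: perron_def)
  obtain Q :: "int poly" where Q1: "lead_coeff Q = 1"
    and Q: "is_min_poly (map_poly of_int Q) (complex_of_real l)"
    using algebraic_int_min_poly[OF alg] by blast
  define n where "n = degree Q"
  define Z where "Z = {z::complex. poly (map_poly of_int Q) z = 0}"
  have cardZ: "card Z = n" and n: "n > 0"
    using card_roots_min_poly[OF Q] by (simp_all add: Z_def n_def)
  then have finZ: "finite Z" by (metis card_gt_0_iff)
  have conj: "conjugates (of_real l) = Z"
    unfolding conjugates_min_poly[OF Q] by (simp add: Z_def map_poly_of_rat_of_int)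
  have lZ: "of_real l \<in> Z" using Q by (simp add: Z_def is_min_poly_def map_poly_of_rat_of_int)
  \<comment> \<open>The inserted \<open>0\<close> covers the case in which \<open>l\<close> is its
    only conjugate.\<close>
  define \<mu> where "\<mu> = Max (insert 0 (norm ` (Z - {of_real l})))"
  have \<mu>0: "0 \<le> \<mu>" unfolding \<mu>_def using finZ by (intro Max_ge) auto
  have \<mu>: "norm z \<le> \<mu>" if "z \<in> Z - {of_real l}" for z
    unfolding \<mu>_def using finZ that by (intro Max_ge) auto
  have \<mu>l: "\<mu> < l"
    unfolding \<mu>_def using finZ l1 assms conj by (subst Max_less_iff) (auto simp: perron_def)
  have normZ: "norm z \<le> l" if "z \<in> Z" for z
    using \<mu>[of z] \<mu>l l1 that by (cases "z = of_real l") auto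
  define C where "C = (\<Sum>k<n. l ^ k)"
  have "l ^ 0 \<le> C" unfolding C_def using n l1 by (intro member_le_sum) auto
  then have C1: "1 \<le> C" by simp
  \<comment> \<open>The pieces will have ideal size \<open>x\<close> between \<open>R / 3\<close>
    and \<open>R / 2\<close>. The gap \<open>(l - \<mu>) * (R / 3) = 2 * C * l\<close> absorbs one
    rounding error \<open>C\<close> at the conjugate and one at \<open>l\<close>. Moreover
    \<open>6 * C \<le> R\<close> keeps the values of the pieces at \<open>l\<close> positive and at
    most \<open>R\<close>.\<close>
  define R where "R = 6 * C * l / (l - \<mu>)"
  have R: "R * (l - \<mu>) = 6 * C * l" using \<mu>l by (simp add: R_def)
  have "6 * C * (l - \<mu>) \<le> R * (l - \<mu>)" unfolding R using \<mu>0 C1 by (intro mult_left_mono) auto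
  then have R6: "6 * C \<le> R" using \<mu>l by simp
  define E where "E f z = poly (map_poly of_int f) z" for f :: "int poly" and z :: complex
  define F where "F f = poly (map_poly of_int f) l" for f :: "int poly"
  have E_l: "E f (of_real l) = of_real (F f)" for f by (simp add: E_def F_def poly_of_int_of_real)
  define \<Omega> where "\<Omega> = {f :: int poly. degree f < n \<and> 0 < F f \<and> F f \<le> R \<and> (\<forall>z\<in>Z - {of_real l}. norm (E f z) \<le> F f)}"
  have fin: "finite \<Omega>"
  proof -
    obtain B where B: "\<And>f k. degree f < card Z \<Longrightarrow> (\<forall>z\<in>Z. norm (poly f z) \<le> R) \<Longrightarrow> norm (coeff f k) \<le> B k"
      using lagrange_coeff_bound[OF finZ] by metis
    have "\<bar>of_int (coeff f k)\<bar> \<le> B k" if "f \<in> \<Omega>" for f k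
    proof -
      have "norm (E f z) \<le> R" if "z \<in> Z" for z
        using \<open>f \<in> \<Omega>\<close> that E_l[of f] by (cases "z = of_real l") (auto simp: \<Omega>_def intro: order_trans)
      then show ?thesis
        using B[of "map_poly of_int f" k] that unfolding E_def cardZ by (simp add: \<Omega>_def coeff_map_poly)
    qed
    then have "\<Omega> \<subseteq> {f. degree f < n \<and> (\<forall>k. \<bar>of_int (coeff f k)\<bar> \<le> B k)}" by (auto simp: \<Omega>_def)
    then show ?thesis by (rule finite_subset) (rule finite_int_poly_bounded_coeffs)
  qed
  have ne: "1 \<in> \<Omega>" using n C1 R6 by (auto simp: \<Omega>_def F_def E_def)
  have split: "\<exists>N ps. (\<forall>j<N. ps j \<in> \<Omega>) \<and> (\<Sum>j<N::nat. F (ps j)) = l * F f" if f: "f \<in> \<Omega>" for f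
  proof -
    \<comment> \<open>The product of \<open>f\<close> with the variable, reduced modulo the monic
      \<open>Q\<close>; at a root \<open>z\<close> of \<open>Q\<close> its value is still
      \<open>z * E f z\<close>.\<close>
    define g where "g = pCons 0 f - Polynomial.smult (coeff f (n - 1)) Q"
    have "degree g \<le> n - 1"
    proof (rule degree_le, intro allI impI)
      fix i assume "n - 1 < i"
      then consider "i = n" | "i > n" by linarith
      then show "coeff g i = 0"
      proof cases
        case 1
        then show ?thesis using Q1 n by (cases n) (auto simp: g_def n_def[symmetric])
      next
        case 2
        then show ?thesis using f by (cases i) (auto simp: g_def \<Omega>_def n_def coeff_eq_0)
      qed
    qed
    then have degg: "degree g < n" using n by simp
    have Eg: "E g z = z * E f z" if "z \<in> Z" for z
      using that by (simp add: E_def g_def Z_def hom_distribs)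
    have Fg: "F g = l * F f" using Eg[OF lZ] unfolding E_l by (simp flip: of_real_mult)
    have Ff: "0 < F f" and Fg0: "0 < F g" using f l1 by (simp_all add: \<Omega>_def Fg)
    have Egn: "l * norm (E g z) \<le> \<mu> * F g" if z: "z \<in> Z - {of_real l}" for z
    proof -
      have "norm z * norm (E f z) \<le> \<mu> * F f"
        using \<mu>[OF z] f z \<mu>0 by (intro mult_mono) (auto simp: \<Omega>_def)
      then show ?thesis using l1 Eg[of z] z by (simp add: norm_mult Fg mult.left_commute)
    qed
    show ?thesis
    proof (cases "F g \<le> R")
      case True
      have "norm (E g z) \<le> F g" if z: "z \<in> Z - {of_real l}" for z
      proof -
        have "\<mu> * F g \<le> l * F g" using \<mu>l Fg0 by (intro mult_right_mono) auto
        then have "l * norm (E g z) \<le> l * F g" using Egn[OF z] by linarith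
        then show ?thesis using l1 by simp
      qed
      then have "g \<in> \<Omega>" using True degg Fg0 by (auto simp: \<Omega>_def)
      then show ?thesis using Fg by (intro exI[of _ 1] exI[of _ "\<lambda>_. g"]) auto
    next
      case False
      \<comment> \<open>As \<open>F g / R > 1\<close>, rounding \<open>2 * F g / R\<close> up gives
        at most \<open>3 * F g / R\<close>; this yields both bounds on \<open>x\<close>.\<close>
      define N where "N = nat \<lceil>2 * F g / R\<rceil>"
      have R0: "R > 0" using R6 C1 by linarith
      have gR: "F g / R > 1" using False R0 by simp
      then have N1: "real N \<ge> 2 * F g / R" "real N \<le> 2 * F g / R + 1" unfolding N_def by linarith+
      then have N3: "real N \<le> 3 * (F g / R)" using gR by simp
      have N0: "N > 0" using N1(1) gR by (cases N) auto
      define x where "x = F g / real N"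
      have x: "x \<le> R / 2" "R / 3 \<le> x"
        using N1(1) N3 N0 R0 by (simp_all add: x_def field_simps)
      have degp: "degree (poly_piece N g j) < n" for j
        using degg degree_map_poly_le le_less_trans unfolding poly_piece_def by blast
      have near: "norm (E (poly_piece N g j) z - E g z / of_nat N) \<le> C" if "z \<in> Z" for j z
        unfolding E_def C_def using N0 degg normZ[OF that] by (rule poly_poly_piece_near)
      have nearl: "\<bar>F (poly_piece N g j) - x\<bar> \<le> C" for j
        unfolding F_def C_def x_def using poly_poly_piece_near[OF N0 degg, of l l j] l1 by simp
      have "poly_piece N g j \<in> \<Omega>" for j
      proof -
        have "norm (E (poly_piece N g j) z) \<le> F (poly_piece N g j)" if z: "z \<in> Z - {of_real l}" for z
        proof -
          have "norm (E (poly_piece N g j) z) \<le> norm (E g z / of_nat N) + C"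
            using near[of z j] z norm_triangle_ineq2[of "E (poly_piece N g j) z" "E g z / of_nat N"] by simp
          moreover have "l * norm (E g z / of_nat N) \<le> \<mu> * x"
            using Egn[OF z] N0 by (simp add: x_def norm_divide divide_right_mono)
          moreover have "(l - \<mu>) * (R / 3) \<le> (l - \<mu>) * x" using x \<mu>l by (intro mult_left_mono) auto
          then have "2 * C * l \<le> l * x - \<mu> * x" using R by (simp add: algebra_simps)
          ultimately have "l * norm (E (poly_piece N g j) z) \<le> l * (x - C)"
            using mult_left_mono[of "norm (E (poly_piece N g j) z)" "norm (E g z / of_nat N) + C" l] l1
            by (simp add: algebra_simps)
          then have "norm (E (poly_piece N g j) z) \<le> x - C" using l1 by simp
          then show ?thesis using nearl[of j] by simp
        qed
        then show ?thesis using degp nearl[of j] x R6 C1 by (auto simp: \<Omega>_def)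
      qed
      moreover have "(\<Sum>j<N. F (poly_piece N g j)) = F g"
        unfolding F_def by (subst (2) sum_poly_piece[OF N0, of g, symmetric]) (simp add: hom_distribs poly_sum)
      ultimately show ?thesis using Fg by auto
    qed
  qed
  then obtain N ps where ps: "\<And>f j. f \<in> \<Omega> \<Longrightarrow> j < N f \<Longrightarrow> ps f j \<in> \<Omega>"
    and sum: "\<And>f. f \<in> \<Omega> \<Longrightarrow> (\<Sum>j<N f::nat. F (ps f j)) = l * F f" by metis
  show ?thesis
  proof (rule positive_eigenvalueI[OF fin])
    show "\<Omega> \<noteq> {}" using ne by blast
    show "0 < F f" if "f \<in> \<Omega>" for f using that by (simp add: \<Omega>_def)
    show "(\<Sum>h\<in>\<Omega>. real (card {j \<in> {..<N f}. ps f j = h}) * F h) = l * F f" if "f \<in> \<Omega>" for f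
      using sum_card_fibres[OF _ fin, of "{..<N f}" "ps f" F] ps[OF that] sum[OF that] by simp
  qed
qed

section \<open>Growth of the recursion\<close>

lemma pigeonhole_subsequence:
  fixes g :: "nat \<Rightarrow> 'b"
  assumes "finite B" "\<And>k. g k \<in> B"
  obtains s b where "strict_mono (s :: nat \<Rightarrow> nat)" "\<And>k. g (s k) = b"
proof -
  have "finite (range g)" using assms by (meson finite_subset image_subsetI)
  then obtain b where b: "infinite (g -` {b} \<inter> UNIV)"
    using inf_img_fin_domE[of g UNIV] by auto
  then have inf: "infinite {k. g k = b}" by (simp add: vimage_def)
  show ?thesis
  proof (rule that)
    show "strict_mono (enumerate {k. g k = b})" using inf by (simp add: strict_mono_enumerate)
    show "g (enumerate {k. g k = b} k) = b" for k using enumerate_in_set[OF inf, of k] by simp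
  qed
qed

lemma bounded_finite_subsequence:
  fixes g :: "nat \<Rightarrow> 'a \<Rightarrow> real"
  assumes "finite A" "\<And>k a. a \<in> A \<Longrightarrow> g k a \<in> {0..b}"
  shows "\<exists>s l. strict_mono (s :: nat \<Rightarrow> nat) \<and> (\<forall>a\<in>A. (\<lambda>k. g (s k) a) \<longlonglongrightarrow> l a)"
  using assms
proof (induction A)
  case empty
  show ?case by (rule exI[of _ id]) (auto simp: strict_mono_def)
next
  case (insert a A)
  then obtain s l where s: "strict_mono (s :: nat \<Rightarrow> nat)" "\<forall>x\<in>A. (\<lambda>k. g (s k) x) \<longlonglongrightarrow> l x"
    by blast
  have "\<forall>k. g (s k) a \<in> {0..b}" using insert.prems by auto
  then obtain y t where t: "strict_mono (t :: nat \<Rightarrow> nat)" "((\<lambda>k. g (s k) a) \<circ> t) \<longlonglongrightarrow> y"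
    using compact_imp_seq_compact[OF compact_Icc[of 0 b]] unfolding seq_compact_def by metis
  have "(\<lambda>k. g ((s \<circ> t) k) x) \<longlonglongrightarrow> (l(a := y)) x" if "x \<in> insert a A" for x
  proof (cases "x = a")
    case True
    then show ?thesis using t(2) by (simp add: comp_def)
  next
    case False
    then have "(\<lambda>k. g (s k) x) \<longlonglongrightarrow> l x" using that s(2) by auto
    from LIMSEQ_subseq_LIMSEQ[OF this t(1)] show ?thesis using False by (simp add: comp_def)
  qed
  moreover have "strict_mono (s \<circ> t)" using s(1) t(1) by (rule strict_mono_o)
  ultimately show ?case by blast
qed

locale tree_recursion =
  fixes I :: "'i set" and d :: nat and T :: "'i \<Rightarrow> (nat \<Rightarrow> 'i) set" and x :: "nat \<Rightarrow> 'i \<Rightarrow> nat"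
  assumes finI: "finite I"
    and finT: "u \<in> I \<Longrightarrow> finite (T u)" and T_nonempty: "u \<in> I \<Longrightarrow> T u \<noteq> {}"
    and T_in: "u \<in> I \<Longrightarrow> \<tau> \<in> T u \<Longrightarrow> e < d \<Longrightarrow> \<tau> e \<in> I"
    and x_0: "u \<in> I \<Longrightarrow> x 0 u = 1"
    and x_Suc: "u \<in> I \<Longrightarrow> x (Suc n) u = (\<Sum>\<tau>\<in>T u. \<Prod>e<d. x n (\<tau> e))"
begin

definition y :: "nat \<Rightarrow> 'i \<Rightarrow> real" where "y n u = ln (real (x n u))"

text \<open>Outside \<open>P\<close> the function \<open>y\<close> vanishes identically, so
  inequalities with an additive gain are imposed on \<open>P\<close> only. On \<open>P\<close> the
  counts reach \<open>2\<close> and, being monotone, never fall back.\<close>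

definition P :: "'i set" where "P = {u \<in> I. \<exists>n. x n u \<noteq> 1}"

lemma P_subset: "u \<in> P \<Longrightarrow> u \<in> I" by (simp add: P_def)

lemma finP: "finite P" using finI by (simp add: P_def)

lemma x_pos: "u \<in> I \<Longrightarrow> 1 \<le> x n u"
proof (induction n arbitrary: u)
  case (Suc n)
  obtain \<tau> where \<tau>: "\<tau> \<in> T u" using T_nonempty[OF Suc.prems] by blast
  have "1 \<le> (\<Prod>e<d. x n (\<tau> e))" using Suc T_in[OF Suc.prems \<tau>] by (intro prod_ge_1) auto
  also have "\<dots> \<le> x (Suc n) u"
    unfolding x_Suc[OF Suc.prems] using finT[OF Suc.prems] \<tau> by (intro member_le_sum) auto
  finally show ?case .
qed (simp add: x_0)

lemma x_le_Suc: "u \<in> I \<Longrightarrow> x n u \<le> x (Suc n) u"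
proof (induction n arbitrary: u)
  case 0
  then show ?case using x_pos[of u "Suc 0"] by (simp add: x_0)
next
  case (Suc n)
  have "(\<Sum>\<tau>\<in>T u. \<Prod>e<d. x n (\<tau> e)) \<le> (\<Sum>\<tau>\<in>T u. \<Prod>e<d. x (Suc n) (\<tau> e))"
    using Suc.IH T_in[OF Suc.prems] by (intro sum_mono prod_mono) auto
  then show ?case by (simp only: x_Suc[OF Suc.prems])
qed

lemma x_mono: "u \<in> I \<Longrightarrow> m \<le> n \<Longrightarrow> x m u \<le> x n u"
  using lift_Suc_mono_le[of "\<lambda>n. x n u"] x_le_Suc by blast

lemma exp_y: "u \<in> I \<Longrightarrow> exp (y n u) = real (x n u)"
  using x_pos[of u n] by (simp add: y_def)

lemma y_nonneg: "u \<in> I \<Longrightarrow> 0 \<le> y n u"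
  using x_pos[of u n] by (simp add: y_def)

lemma y_outside_P: "u \<in> I \<Longrightarrow> u \<notin> P \<Longrightarrow> y n u = 0"
  by (simp add: P_def y_def)

lemma exp_sum_y:
  assumes "u \<in> I" "\<tau> \<in> T u"
  shows "exp (\<Sum>e<d. y n (\<tau> e)) = real (\<Prod>e<d. x n (\<tau> e))"
  using T_in[OF assms] by (simp add: exp_sum exp_y)

lemma y_Suc_ge:
  assumes "u \<in> I" "\<tau> \<in> T u"
  shows "(\<Sum>e<d. y n (\<tau> e)) \<le> y (Suc n) u"
proof -
  have "(\<Prod>e<d. x n (\<tau> e)) \<le> x (Suc n) u"
    unfolding x_Suc[OF assms(1)] using finT[OF assms(1)] assms(2) by (intro member_le_sum) auto
  then have "exp (\<Sum>e<d. y n (\<tau> e)) \<le> exp (y (Suc n) u)"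
    unfolding exp_sum_y[OF assms] exp_y[OF assms(1)] by (simp only: of_nat_le_iff)
  then show ?thesis by simp
qed

lemma y_Suc_le:
  assumes "u \<in> I" "\<And>\<tau>. \<tau> \<in> T u \<Longrightarrow> (\<Sum>e<d. y n (\<tau> e)) \<le> b"
  shows "y (Suc n) u \<le> ln (real (card (T u))) + b"
proof -
  have "exp (y (Suc n) u) = (\<Sum>\<tau>\<in>T u. exp (\<Sum>e<d. y n (\<tau> e)))"
    unfolding exp_y[OF assms(1)] x_Suc[OF assms(1)] using assms(1) by (simp add: exp_sum_y)
  also have "\<dots> \<le> (\<Sum>\<tau>\<in>T u. exp b)" using assms(2) by (intro sum_mono) auto
  also have "\<dots> = exp (ln (real (card (T u))) + b)"
    using finT[OF assms(1)] T_nonempty[OF assms(1)] by (simp add: exp_add card_gt_0_iff)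
  finally show ?thesis by simp
qed

section \<open>Supersolutions and optimal solutions\<close>

lemma ex_uniform_positive: "\<exists>N. \<forall>u\<in>P. ln 2 \<le> y N u"
proof -
  have "\<forall>u\<in>P. \<exists>n. x n u \<noteq> 1" by (simp add: P_def)
  then obtain m where m: "\<And>u. u \<in> P \<Longrightarrow> x (m u) u \<noteq> 1" by metis
  define N where "N = (\<Sum>u\<in>P. m u)"
  have "ln 2 \<le> y N u" if u: "u \<in> P" for u
  proof -
    have "m u \<le> N" unfolding N_def using finP u by (intro member_le_sum) auto
    then have "x (m u) u \<le> x N u" using x_mono P_subset[OF u] by blast
    then have "2 \<le> x N u" using m[OF u] x_pos[OF P_subset[OF u], of "m u"] by linarith
    then show ?thesis by (simp add: y_def)
  qed
  then show ?thesis by blast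
qed

text \<open>The recursion for \<open>y\<close> exceeds its max-plus version by at most
  \<open>ln (card (T u))\<close>. Scaling \<open>v\<close> by \<open>K\<close> raises the slack
  \<open>c\<close> to at least this size, and the factor \<open>r ^ n\<close> only enlarges it, so
  \<open>K * r ^ n * v u\<close> dominates \<open>y\<close> by induction.\<close>

lemma growth_le_supersolution:
  assumes r: "r > 1" and c: "c > 0" and v: "\<And>u. v u \<ge> 0"
    and sup: "\<And>u \<tau>. u \<in> P \<Longrightarrow> \<tau> \<in> T u \<Longrightarrow> (\<Sum>e<d. v (\<tau> e)) + c \<le> r * v u"
  shows "\<exists>K\<ge>0. \<forall>n. \<forall>u\<in>I. y n u \<le> K * r ^ n"
proof -
  define C where "C = (\<Sum>u\<in>I. ln (real (card (T u))))"
  have lnT: "0 \<le> ln (real (card (T u)))" if "u \<in> I" for u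
    using finT[OF that] T_nonempty[OF that] by (simp add: Suc_le_eq card_gt_0_iff)
  then have C: "ln (real (card (T u))) \<le> C" if "u \<in> I" for u
    unfolding C_def using finI that by (intro member_le_sum) auto
  have C0: "0 \<le> C" unfolding C_def using lnT by (rule sum_nonneg)
  define K where "K = C / c"
  have K0: "0 \<le> K" using C0 c by (simp add: K_def)
  have le: "y n u \<le> K * r ^ n * v u" if "u \<in> I" for n u
    using that
  proof (induction n arbitrary: u)
    case 0
    then show ?case using K0 v[of u] by (simp add: y_def x_0)
  next
    case (Suc n)
    have Kr: "0 \<le> K * r ^ n" using K0 r by simp
    show ?case
    proof (cases "u \<in> P")
      case False
      then show ?thesis using y_outside_P[OF Suc.prems] K0 r v[of u] by simp
    next
      case True
      have "(\<Sum>e<d. y n (\<tau> e)) \<le> K * r ^ n * (r * v u - c)" if \<tau>: "\<tau> \<in> T u" for \<tau>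
      proof -
        have "(\<Sum>e<d. y n (\<tau> e)) \<le> (\<Sum>e<d. K * r ^ n * v (\<tau> e))"
          using Suc.IH T_in[OF Suc.prems \<tau>] by (intro sum_mono) auto
        also have "\<dots> = K * r ^ n * (\<Sum>e<d. v (\<tau> e))" by (simp add: sum_distrib_left)
        also have "\<dots> \<le> K * r ^ n * (r * v u - c)"
          using sup[OF True \<tau>] Kr by (intro mult_left_mono) auto
        finally show ?thesis .
      qed
      from y_Suc_le[OF Suc.prems this]
      have "y (Suc n) u \<le> C + K * r ^ n * (r * v u - c)" using C[OF Suc.prems] by simp
      moreover have "K * c * 1 \<le> K * c * r ^ n" using r K0 c by (intro mult_left_mono) auto
      then have "C \<le> K * r ^ n * c" using c by (simp add: K_def mult_ac)
      ultimately show ?thesis by (simp add: algebra_simps)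
    qed
  qed
  define K' where "K' = K * (\<Sum>u\<in>I. v u)"
  have "y n u \<le> K' * r ^ n" if "u \<in> I" for n u
  proof -
    have "v u \<le> (\<Sum>u\<in>I. v u)" using finI v that by (intro member_le_sum) auto
    then have "K * r ^ n * v u \<le> K * r ^ n * (\<Sum>u\<in>I. v u)"
      using K0 r by (intro mult_left_mono) auto
    then show ?thesis using le[OF that, of n] by (simp add: K'_def mult_ac)
  qed
  moreover have "0 \<le> K'" using K0 v by (simp add: K'_def sum_nonneg)
  ultimately show ?thesis by blast
qed

text \<open>
  For \<open>r\<close> above the growth rate, \<open>\<Sum>n. y (n + N) u / r ^ n\<close> is a strict supersolution.
\<close>

lemma ex_supersolution:
  assumes r1: "1 < r1" "r1 < r"
    and le: "\<forall>\<^sub>F n in sequentially. \<forall>u\<in>I. y n u \<le> r1 ^ n"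
  shows "\<exists>V. (\<forall>u\<in>I. 0 \<le> V u) \<and> (\<forall>u\<in>P. \<forall>\<tau>\<in>T u. (\<Sum>e<d. V (\<tau> e)) + 1 \<le> r * V u)"
proof -
  obtain N where N: "\<And>u. u \<in> P \<Longrightarrow> ln 2 \<le> y N u" using ex_uniform_positive by blast
  have r: "r > 1" using r1 by simp
  define W where "W u = (\<Sum>n. y (n + N) u / r ^ n)" for u
  have summ0: "summable (\<lambda>n. y n u / r ^ n)" if "u \<in> I" for u
  proof (rule summable_comparison_test_ev)
    show "\<forall>\<^sub>F n in sequentially. norm (y n u / r ^ n) \<le> (r1 / r) ^ n"
      using le
    proof eventually_elim
      case (elim n)
      then show ?case using y_nonneg[OF that] that r by (simp add: power_divide divide_right_mono)
    qed
    show "summable (\<lambda>n. (r1 / r) ^ n)" using r1 by (intro summable_geometric) simp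
  qed
  have summ: "summable (\<lambda>n. y (n + k) u / r ^ n)" if "u \<in> I" for u k
  proof -
    have "summable (\<lambda>n. r ^ k * (y (n + k) u / r ^ (n + k)))"
      using summ0[OF that] summable_iff_shift[of "\<lambda>n. y n u / r ^ n" k] by (intro summable_mult) blast
    then show ?thesis using r by (simp add: power_add)
  qed
  have W0: "0 \<le> W u" if "u \<in> I" for u
    unfolding W_def using summ[OF that] y_nonneg[OF that] r by (intro suminf_nonneg) auto
  have W: "(\<Sum>e<d. W (\<tau> e)) + ln 2 \<le> r * W u" if u: "u \<in> P" and \<tau>: "\<tau> \<in> T u" for u \<tau>
  proof -
    have uI: "u \<in> I" using u by (rule P_subset)
    have \<tau>I: "\<tau> e \<in> I" if "e < d" for e using T_in[OF uI \<tau> that] .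
    have "(\<Sum>e<d. W (\<tau> e)) = (\<Sum>n. \<Sum>e<d. y (n + N) (\<tau> e) / r ^ n)"
      unfolding W_def using summ \<tau>I by (intro suminf_sum[symmetric]) auto
    also have "\<dots> \<le> (\<Sum>n. y (n + Suc N) u / r ^ n)"
    proof (rule suminf_le)
      show "(\<Sum>e<d. y (n + N) (\<tau> e) / r ^ n) \<le> y (n + Suc N) u / r ^ n" for n
        using y_Suc_ge[OF uI \<tau>, of "n + N"] r by (simp add: divide_right_mono flip: sum_divide_distrib)
      show "summable (\<lambda>n. \<Sum>e<d. y (n + N) (\<tau> e) / r ^ n)" using summ \<tau>I by (intro summable_sum) auto
      show "summable (\<lambda>n. y (n + Suc N) u / r ^ n)" by (rule summ[OF uI])
    qed
    also have "\<dots> = (\<Sum>n. r * (y (Suc n + N) u / r ^ Suc n))" using r by simp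
    also have "\<dots> = r * (\<Sum>n. y (Suc n + N) u / r ^ Suc n)"
      using summ[OF uI, of N] summable_Suc_iff[of "\<lambda>n. y (n + N) u / r ^ n"] by (intro suminf_mult) blast
    \<comment> \<open>Shifting the series drops its first term. The resulting slack
      \<open>r * y N u\<close> is at least \<open>ln 2\<close> by the choice of \<open>N\<close>,
      and dividing by \<open>ln 2\<close> normalises it to \<open>1\<close>.\<close>
    also have "\<dots> = r * (W u - y N u)"
      unfolding W_def by (subst suminf_split_head[OF summ[OF uI, of N]]) simp
    finally have "(\<Sum>e<d. W (\<tau> e)) \<le> r * (W u - y N u)" .
    moreover have "1 * ln 2 \<le> r * y N u" using N[OF u] r by (intro mult_mono) auto
    ultimately show ?thesis by (simp add: algebra_simps)
  qed
  define V where "V u = W u / ln 2" for u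
  have "(\<Sum>e<d. V (\<tau> e)) + 1 \<le> r * V u" if "u \<in> P" "\<tau> \<in> T u" for u \<tau>
  proof -
    have "((\<Sum>e<d. W (\<tau> e)) + ln 2) / ln 2 \<le> r * W u / ln 2"
      using W[OF that] by (intro divide_right_mono) auto
    then show ?thesis by (simp add: V_def add_divide_distrib sum_divide_distrib)
  qed
  then show ?thesis using W0 by (intro exI[of _ V]) (auto simp: V_def)
qed

text \<open>Value iteration from zero: the iterates increase, stay below the supersolution
  \<open>V\<close> and therefore converge. The maximum is over finitely many tuples, so the limit
  solves the equation exactly and some tuple \<open>\<pi> u\<close> attains it.\<close>

lemma ex_optimal_solution:
  fixes r :: real
  assumes r: "r > 0" and V0: "\<And>u. u \<in> I \<Longrightarrow> 0 \<le> V u"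
    and V: "\<And>u \<tau>. u \<in> P \<Longrightarrow> \<tau> \<in> T u \<Longrightarrow> (\<Sum>e<d. V (\<tau> e)) + 1 \<le> r * V u"
  shows "\<exists>v \<pi>. (\<forall>u. 0 \<le> v u) \<and> (\<forall>u. u \<notin> P \<longrightarrow> v u = 0) \<and>
    (\<forall>u\<in>P. \<pi> u \<in> T u \<and> (\<Sum>e<d. v (\<pi> u e)) + 1 = r * v u \<and>
      (\<forall>\<tau>\<in>T u. (\<Sum>e<d. v (\<tau> e)) + 1 \<le> r * v u))"
proof -
  define f where "f a u = Max ((\<lambda>\<tau>. \<Sum>e<d. a (\<tau> e)) ` T u)" for a :: "'i \<Rightarrow> real" and u
  have f_ge: "(\<Sum>e<d. a (\<tau> e)) \<le> f a u" if "u \<in> P" "\<tau> \<in> T u" for a u \<tau>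
    unfolding f_def using that finT[OF P_subset] by (intro Max_ge) auto
  have f_ex: "\<exists>\<tau>\<in>T u. f a u = (\<Sum>e<d. a (\<tau> e))" if "u \<in> P" for a u
  proof -
    have "f a u \<in> (\<lambda>\<tau>. \<Sum>e<d. a (\<tau> e)) ` T u"
      unfolding f_def using finT[OF P_subset[OF that]] T_nonempty[OF P_subset[OF that]] by (intro Max_in) auto
    then show ?thesis by auto
  qed
  have f_mono: "f a u \<le> f b u" if "u \<in> P" "\<And>w. a w \<le> b w" for a b u
  proof -
    obtain \<tau> where \<tau>: "\<tau> \<in> T u" "f a u = (\<Sum>e<d. a (\<tau> e))" using f_ex[OF \<open>u \<in> P\<close>] by blast
    have "(\<Sum>e<d. a (\<tau> e)) \<le> (\<Sum>e<d. b (\<tau> e))" using that(2) by (intro sum_mono) auto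
    also have "\<dots> \<le> f b u" by (rule f_ge[OF that(1) \<tau>(1)])
    finally show ?thesis using \<tau>(2) by simp
  qed
  define it where "it = rec_nat (\<lambda>_. 0 :: real) (\<lambda>_ a u. if u \<in> P then (f a u + 1) / r else 0)"
  have it_0: "it 0 u = 0" for u by (simp add: it_def)
  have it_Suc: "it (Suc k) u = (if u \<in> P then (f (it k) u + 1) / r else 0)" for k u
    by (simp add: it_def)
  have it_out: "it k u = 0" if "u \<notin> P" for k u using that by (cases k) (simp_all add: it_0 it_Suc)
  have it_mono: "0 \<le> it k u \<and> it k u \<le> it (Suc k) u" for k u
  proof (induction k arbitrary: u)
    case 0
    have "0 \<le> f (it 0) u" if u: "u \<in> P" using f_ex[OF u, of "it 0"] by (auto simp: it_0)
    then show ?case using r by (simp add: it_0 it_Suc)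
  next
    case (Suc k)
    have "it (Suc k) u \<le> it (Suc (Suc k)) u"
      using f_mono[of u "it k" "it (Suc k)"] Suc r by (simp add: it_Suc[of "Suc k"] it_Suc[of k u] divide_right_mono)
    then show ?case using Suc[of u] by linarith
  qed
  have it_le: "it k u \<le> V u" if "u \<in> I" for k u
    using that
  proof (induction k arbitrary: u)
    case 0
    then show ?case using V0 by (simp add: it_0)
  next
    case (Suc k)
    show ?case
    proof (cases "u \<in> P")
      case True
      obtain \<tau> where \<tau>: "\<tau> \<in> T u" "f (it k) u = (\<Sum>e<d. it k (\<tau> e))" using f_ex[OF True] by blast
      have "f (it k) u \<le> (\<Sum>e<d. V (\<tau> e))"
        unfolding \<tau>(2) using Suc.IH T_in[OF Suc.prems \<tau>(1)] by (intro sum_mono) auto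
      then have "f (it k) u + 1 \<le> r * V u" using V[OF True \<tau>(1)] by linarith
      then show ?thesis using True r by (simp add: it_Suc pos_divide_le_eq mult.commute)
    next
      case False
      then show ?thesis using V0[OF Suc.prems] by (simp add: it_out)
    qed
  qed
  have "\<exists>l. (\<lambda>k. it k u) \<longlonglongrightarrow> l" for u
  proof (cases "u \<in> I")
    case True
    have "incseq (\<lambda>k. it k u)" using it_mono by (intro incseq_SucI) blast
    then show ?thesis using incseq_convergent[of "\<lambda>k. it k u" "V u"] it_le[OF True] by metis
  next
    case False
    then have "u \<notin> P" using P_subset by blast
    then show ?thesis using it_out by (intro exI[of _ 0]) simp
  qed
  then obtain v where v: "\<And>u. (\<lambda>k. it k u) \<longlonglongrightarrow> v u" by metis
  have v0: "0 \<le> v u" for u using v[of u] it_mono by (intro LIMSEQ_le_const) auto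
  have vout: "v u = 0" if "u \<notin> P" for u
    using v[of u] it_out[OF that] by (simp add: LIMSEQ_const_iff)
  have it_v: "it k u \<le> v u" for k u
    using incseq_le[of "\<lambda>k. it k u" "v u" k] v it_mono by (simp add: incseq_SucI)
  have rit: "(\<lambda>k. r * it (Suc k) u) \<longlonglongrightarrow> r * v u" for u
    by (intro tendsto_mult tendsto_const LIMSEQ_Suc v)
  have ge: "(\<Sum>e<d. v (\<tau> e)) + 1 \<le> r * v u" if u: "u \<in> P" and \<tau>: "\<tau> \<in> T u" for u \<tau>
  proof (rule LIMSEQ_le[OF _ rit])
    show "(\<lambda>k. (\<Sum>e<d. it k (\<tau> e)) + 1) \<longlonglongrightarrow> (\<Sum>e<d. v (\<tau> e)) + 1"
      by (intro tendsto_add tendsto_sum tendsto_const v)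
    have "(\<Sum>e<d. it k (\<tau> e)) + 1 \<le> r * it (Suc k) u" for k
      using f_ge[OF u \<tau>, of "it k"] u r by (simp add: it_Suc)
    then show "\<exists>N. \<forall>k\<ge>N. (\<Sum>e<d. it k (\<tau> e)) + 1 \<le> r * it (Suc k) u" by blast
  qed
  have "\<exists>\<tau>\<in>T u. (\<Sum>e<d. v (\<tau> e)) + 1 = r * v u" if u: "u \<in> P" for u
  proof -
    \<comment> \<open>The iterates lie below \<open>v\<close>, so by monotonicity the maximum taken
      at \<open>v\<close> bounds every step; a maximising tuple then turns \<open>ge\<close> into an
      equality.\<close>
    have "r * v u \<le> f v u + 1"
    proof (rule LIMSEQ_le_const2[OF rit])
      have "r * it (Suc k) u \<le> f v u + 1" for k
        using f_mono[OF u, of "it k" v] it_v u r by (simp add: it_Suc)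
      then show "\<exists>N. \<forall>k\<ge>N. r * it (Suc k) u \<le> f v u + 1" by blast
    qed
    then show ?thesis using f_ex[OF u, of v] ge[OF u] by fastforce
  qed
  then obtain \<pi> where "\<And>u. u \<in> P \<Longrightarrow> \<pi> u \<in> T u \<and> (\<Sum>e<d. v (\<pi> u e)) + 1 = r * v u" by metis
  then show ?thesis using v0 vout ge by (intro exI[of _ v] exI[of _ \<pi>]) blast
qed

end

section \<open>Passage to the critical rate\<close>

context tree_recursion begin

definition total :: "nat \<Rightarrow> nat" where "total n = (\<Sum>u\<in>I. x n u)"

lemma y_le_ln_total:
  assumes "u \<in> I"
  shows "y n u \<le> ln (real (total n))"
proof -
  have "x n u \<le> total n" unfolding total_def using finI assms by (intro member_le_sum) auto
  then show ?thesis using x_pos[OF assms, of n] by (simp add: y_def)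
qed

lemma eventually_y_le_power:
  assumes lim: "(\<lambda>n. ln (ln (real (total n))) / real n) \<longlonglongrightarrow> h" and r: "h < ln r" "0 < r"
  shows "\<forall>\<^sub>F n in sequentially. \<forall>u\<in>I. y n u \<le> r ^ n"
  using order_tendstoD(2)[OF lim r(1)] eventually_gt_at_top[of 0]
proof eventually_elim
  case (elim n)
  have "ln (real (total n)) \<le> r ^ n"
  proof (cases "ln (real (total n)) > 0")
    case True
    have "ln (ln (real (total n))) < real n * ln r" using elim by (simp add: pos_divide_less_eq mult.commute)
    then have "exp (ln (ln (real (total n)))) \<le> exp (real n * ln r)" by simp
    then show ?thesis using True r(2) by (simp add: exp_of_nat_mult)
  qed (use r(2) in \<open>simp add: order_trans[OF _ zero_le_power]\<close>)
  then show ?case using y_le_ln_total order_trans by blast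
qed

text \<open>The constants \<open>K\<close> and \<open>card I\<close> contribute only a bounded term
  to the double logarithm, and division by \<open>n\<close> removes it.\<close>

lemma rate_le_of_bound:
  assumes two: "\<forall>\<^sub>F n in sequentially. 2 \<le> total n"
    and lim: "(\<lambda>n. ln (ln (real (total n))) / real n) \<longlonglongrightarrow> h"
    and r: "1 < r" and K: "0 \<le> K" "\<And>n u. u \<in> I \<Longrightarrow> y n u \<le> K * r ^ n"
  shows "h \<le> ln r"
proof -
  have cI: "1 \<le> real (card I)"
  proof -
    have "I \<noteq> {}" using eventually_happens[OF two] by (auto simp: total_def)
    then show ?thesis using finI by (simp add: Suc_le_eq card_gt_0_iff)
  qed
  define K' where "K' = ln (real (card I)) + K + 1"
  have K': "1 \<le> K'" using cI K(1) by (simp add: K'_def)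
  have "\<forall>\<^sub>F n in sequentially. ln (ln (real (total n))) / real n \<le> ln K' / real n + ln r"
    using two eventually_gt_at_top[of 0]
  proof eventually_elim
    case (elim n)
    have "real (total n) = (\<Sum>u\<in>I. exp (y n u))" by (simp add: total_def exp_y)
    also have "\<dots> \<le> (\<Sum>u\<in>I. exp (K * r ^ n))" using K(2) by (intro sum_mono) auto
    also have "\<dots> = exp (ln (real (card I)) + K * r ^ n)" using cI by (simp add: exp_add)
    finally have "ln (real (total n)) \<le> ln (real (card I)) + K * r ^ n"
      using elim ln_le_cancel_iff[of "real (total n)" "exp (ln (real (card I)) + K * r ^ n)"] by simp
    also have "\<dots> \<le> K' * r ^ n"
    proof -
      have "1 \<le> r ^ n" using r by simp
      then have "ln (real (card I)) * 1 \<le> ln (real (card I)) * r ^ n" using cI by (intro mult_left_mono) auto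
      then show ?thesis using \<open>1 \<le> r ^ n\<close> by (simp add: K'_def algebra_simps)
    qed
    finally have "ln (ln (real (total n))) \<le> ln (K' * r ^ n)" using elim by (intro ln_mono) auto
    also have "\<dots> = ln K' + real n * ln r" using K' r by (simp add: ln_mult ln_realpow)
    finally have "ln (ln (real (total n))) / real n \<le> (ln K' + real n * ln r) / real n"
      by (intro divide_right_mono) auto
    then show ?case using elim by (simp add: add_divide_distrib)
  qed
  moreover have "(\<lambda>n. ln K' / real n + ln r) \<longlonglongrightarrow> 0 + ln r"
    by (intro tendsto_add tendsto_const lim_const_over_n)
  ultimately show ?thesis using tendsto_le[OF sequentially_bot _ lim] by simp
qed

lemma ex_optimal_eigenvector:
  assumes two: "\<forall>\<^sub>F n in sequentially. 2 \<le> total n"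
    and lim: "(\<lambda>n. ln (ln (real (total n))) / real n) \<longlonglongrightarrow> h" and h: "h > 0"
  shows "\<exists>w \<pi>. (\<forall>u. 0 \<le> w u) \<and> (\<forall>u. u \<notin> P \<longrightarrow> w u = 0) \<and> (\<exists>u\<in>P. w u = 1) \<and>
    (\<forall>u\<in>P. \<pi> u \<in> T u \<and> (\<Sum>e<d. w (\<pi> u e)) = exp h * w u)"
proof -
  define r where "r k = exp h + 1 / real (Suc k)" for k
  have eh: "1 < exp h" using h by simp
  \<comment> \<open>Otherwise \<open>y\<close> vanishes on \<open>I\<close> and the rate could not
    exceed \<open>h / 2\<close>.\<close>
  have P: "P \<noteq> {}"
  proof
    assume "P = {}"
    then have "y n u = 0" if "u \<in> I" for n u using y_outside_P[OF that] by simp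
    then have "h \<le> ln (exp (h / 2))"
      using rate_le_of_bound[OF two lim, of "exp (h / 2)" 0] h by simp
    then show False using h by simp
  qed
  define optimal where "optimal k v \<pi> \<longleftrightarrow> (\<forall>u. 0 \<le> v u) \<and> (\<forall>u. u \<notin> P \<longrightarrow> v u = 0) \<and>
    (\<forall>u\<in>P. \<pi> u \<in> T u \<and> (\<Sum>e<d. v (\<pi> u e)) + 1 = r k * v u \<and>
      (\<forall>\<tau>\<in>T u. (\<Sum>e<d. v (\<tau> e)) + 1 \<le> r k * v u))" for k v \<pi>
  have "\<exists>v \<pi>. optimal k v \<pi>" for k
  proof -
    \<comment> \<open>An intermediate rate: \<open>y\<close> is eventually below
      \<open>r1 ^ n\<close>, and the margin between \<open>r1\<close> and \<open>r k\<close> makes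
      the series behind the supersolution converge.\<close>
    define r1 where "r1 = exp h + 1 / (2 * real (Suc k))"
    have "0 < 1 / (2 * real (Suc k))" by simp
    moreover have "1 / (2 * real (Suc k)) < 1 / real (Suc k)" by (rule divide_strict_left_mono) auto
    ultimately have r1: "1 < r1" "r1 < r k" "exp h < r1" unfolding r1_def r_def using eh by linarith+
    have "h < ln r1" using r1 ln_less_cancel_iff[of "exp h" r1] by simp
    then have "\<forall>\<^sub>F n in sequentially. \<forall>u\<in>I. y n u \<le> r1 ^ n"
      using eventually_y_le_power[OF lim] r1(1) by simp
    from ex_supersolution[OF r1(1,2) this] obtain V where
      "\<forall>u\<in>I. 0 \<le> V u" "\<forall>u\<in>P. \<forall>\<tau>\<in>T u. (\<Sum>e<d. V (\<tau> e)) + 1 \<le> r k * V u" by blast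
    then show ?thesis unfolding optimal_def using r1 by (intro ex_optimal_solution[of "r k" V]) auto
  qed
  then obtain v \<pi> where "\<And>k. optimal k (v k) (\<pi> k)" by metis
  then have v0: "\<And>k u. 0 \<le> v k u" and vout: "\<And>k u. u \<notin> P \<Longrightarrow> v k u = 0"
    and \<pi>: "\<And>k u. u \<in> P \<Longrightarrow> \<pi> k u \<in> T u"
    and veq: "\<And>k u. u \<in> P \<Longrightarrow> (\<Sum>e<d. v k (\<pi> k u e)) + 1 = r k * v k u"
    and vle: "\<And>k u \<tau>. u \<in> P \<Longrightarrow> \<tau> \<in> T u \<Longrightarrow> (\<Sum>e<d. v k (\<tau> e)) + 1 \<le> r k * v k u"
    unfolding optimal_def by blast+
  have r0: "0 < r k" "r k \<le> exp h + 1" for k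
    unfolding r_def by (intro add_pos_pos) simp_all
  define s where "s k = Max (v k ` P)" for k
  have "\<exists>m\<in>P. v k m = s k" for k
  proof -
    have "s k \<in> v k ` P" unfolding s_def using finP P by (intro Max_in) auto
    then show ?thesis by auto
  qed
  then obtain m where m: "\<And>k. m k \<in> P" "\<And>k. v k (m k) = s k" by metis
  have vs: "v k u \<le> s k" for k u
  proof (cases "u \<in> P")
    case True
    then show ?thesis unfolding s_def using finP by (intro Max_ge) auto
  next
    case False
    then show ?thesis using vout[OF False] v0[of k "m k"] m(2) by simp
  qed
  \<comment> \<open>At the maximum, \<open>r k * s k\<close> is \<open>1\<close> plus a nonnegative
    sum. Hence \<open>1 / s k\<close> stays bounded by \<open>exp h + 1\<close>, which the
    compactness argument needs.\<close>
  have rs: "1 \<le> r k * s k" for k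
    using veq[OF m(1)[of k], of k] m(2)[of k] sum_nonneg[of "{..<d}" "\<lambda>e. v k (\<pi> k (m k) e)"] v0 by simp
  have s0: "0 < s k" for k
  proof -
    have "0 < r k * s k" using rs[of k] by linarith
    then show ?thesis using r0(1)[of k] by (simp add: zero_less_mult_iff)
  qed
  \<comment> \<open>Restricted to \<open>P\<close>, only finitely many choices of tuples exist.
    Freezing the place of the maximum as well makes the limit equal to \<open>1\<close> there, hence
    nonzero.\<close>
  let ?B = "(PiE P T) \<times> P"
  have finB: "finite ?B"
    by (intro finite_cartesian_product finite_PiE finP) (rule finT[OF P_subset])
  have inB: "(restrict (\<pi> k) P, m k) \<in> ?B" for k
    using \<pi> m(1) by (intro SigmaI restrict_PiE_iff[THEN iffD2] ballI)
  obtain s1 b where s1: "strict_mono (s1 :: nat \<Rightarrow> nat)"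
    "\<And>k. (restrict (\<pi> (s1 k)) P, m (s1 k)) = b"
    using pigeonhole_subsequence[of ?B "\<lambda>k. (restrict (\<pi> k) P, m k)", OF finB inB] by blast
  define \<rho> where "\<rho> = fst b"
  define a where "a = snd b"
  have \<rho>: "\<pi> (s1 k) u = \<rho> u" if "u \<in> P" for k u
    using arg_cong[OF s1(2)[of k], of "\<lambda>b. fst b u"] that by (simp add: \<rho>_def)
  have a: "m (s1 k) = a" for k using s1(2)[of k] by (auto simp: a_def)
  \<comment> \<open>The coordinate \<open>None\<close> carries the normalised additive constant, so
    one extraction handles both it and the vector.\<close>
  define g where "g k z = (case z of None \<Rightarrow> 1 / s (s1 k) | Some u \<Rightarrow> v (s1 k) u / s (s1 k))" for k z
  have gin: "g k z \<in> {0..exp h + 1}" for k z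
  proof (cases z)
    case None
    have "r (s1 k) * s (s1 k) \<le> (exp h + 1) * s (s1 k)"
      using r0(2) s0[of "s1 k"] by (intro mult_right_mono) auto
    then have "1 \<le> (exp h + 1) * s (s1 k)" using rs[of "s1 k"] by linarith
    then show ?thesis using s0[of "s1 k"] by (simp add: g_def None pos_divide_le_eq)
  next
    case (Some u)
    have "v (s1 k) u / s (s1 k) \<le> 1" using vs[of "s1 k" u] s0[of "s1 k"] by simp
    moreover have "0 \<le> v (s1 k) u / s (s1 k)" using v0 s0 by (intro divide_nonneg_pos)
    ultimately show ?thesis unfolding g_def Some option.case atLeastAtMost_iff using eh by linarith
  qed
  obtain s2 l where s2: "strict_mono (s2 :: nat \<Rightarrow> nat)"
    and l: "\<forall>z\<in>insert None (Some ` P). (\<lambda>k. g (s2 k) z) \<longlonglongrightarrow> l z"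
    using bounded_finite_subsequence[of "insert None (Some ` P)" g "exp h + 1"] finP gin by blast
  define q where "q k = s1 (s2 k)" for k
  define c where "c = l None"
  define w where "w u = (if u \<in> P then l (Some u) else 0)" for u
  have lc: "(\<lambda>k. 1 / s (q k)) \<longlonglongrightarrow> c"
    using l by (simp add: g_def c_def q_def)
  have lw: "(\<lambda>k. v (q k) u / s (q k)) \<longlonglongrightarrow> w u" for u
  proof (cases "u \<in> P")
    case True
    then show ?thesis using l by (simp add: g_def w_def q_def)
  qed (simp add: w_def vout)
  have lr: "(\<lambda>k. r (q k)) \<longlonglongrightarrow> exp h"
  proof -
    have "(\<lambda>k. exp h + 1 / real (Suc k)) \<longlonglongrightarrow> exp h + 0"
      by (intro tendsto_add tendsto_const LIMSEQ_Suc[OF lim_const_over_n])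
    then have "r \<longlonglongrightarrow> exp h" unfolding r_def[abs_def] by (simp only: add_0_right)
    moreover have "strict_mono q" using strict_mono_o[OF s1(1) s2] unfolding q_def[abs_def] comp_def .
    ultimately show ?thesis using LIMSEQ_subseq_LIMSEQ[of r "exp h" q] by (simp add: comp_def)
  qed
  have lsum: "(\<lambda>k. ((\<Sum>e<d. v (q k) (\<tau> e)) + 1) / s (q k)) \<longlonglongrightarrow> (\<Sum>e<d. w (\<tau> e)) + c" for \<tau>
    unfolding add_divide_distrib sum_divide_distrib
    by (intro tendsto_add tendsto_sum lw lc)
  have lrv: "(\<lambda>k. r (q k) * v (q k) u / s (q k)) \<longlonglongrightarrow> exp h * w u" for u
    using tendsto_mult[OF lr lw[of u]] by simp
  have w0: "0 \<le> w u" for u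
    using lw[of u] v0 s0 by (intro LIMSEQ_le_const) (auto simp: less_imp_le)
  have w1: "w u \<le> 1" for u
    using lw[of u] vs s0 by (intro LIMSEQ_le_const2) auto
  have wa: "w a = 1" "a \<in> P"
  proof -
    have "(\<lambda>k. v (q k) a / s (q k)) = (\<lambda>k. 1)"
    proof
      fix k show "v (q k) a / s (q k) = 1"
        using m(2)[of "q k"] s0[of "q k"] a[of "s2 k"] by (simp add: q_def)
    qed
    then show "w a = 1" using lw[of a] by (simp add: LIMSEQ_const_iff)
    show "a \<in> P" using m(1)[of "s1 0"] a by simp
  qed
  have wle: "(\<Sum>e<d. w (\<tau> e)) + c \<le> exp h * w u" if "u \<in> P" "\<tau> \<in> T u" for u \<tau>
  proof (rule LIMSEQ_le[OF lsum lrv])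
    have "((\<Sum>e<d. v (q k) (\<tau> e)) + 1) / s (q k) \<le> r (q k) * v (q k) u / s (q k)" for k
      using vle[OF that] s0[of "q k"] by (intro divide_right_mono) auto
    then show "\<exists>N. \<forall>k\<ge>N. ((\<Sum>e<d. v (q k) (\<tau> e)) + 1) / s (q k) \<le> r (q k) * v (q k) u / s (q k)"
      by blast
  qed
  have weq: "(\<Sum>e<d. w (\<rho> u e)) + c = exp h * w u" if "u \<in> P" for u
  proof (rule LIMSEQ_unique[OF lsum])
    have "\<pi> (q k) u = \<rho> u" for k unfolding q_def by (rule \<rho>[OF that])
    then have "(\<Sum>e<d. v (q k) (\<rho> u e)) + 1 = r (q k) * v (q k) u" for k
      using veq[OF that, of "q k"] by simp
    then show "(\<lambda>k. ((\<Sum>e<d. v (q k) (\<rho> u e)) + 1) / s (q k)) \<longlonglongrightarrow> exp h * w u"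
      using lrv[of u] by (simp only:)
  qed
  have \<rho>T: "\<rho> u \<in> T u" if "u \<in> P" for u using \<pi>[OF that, of "s1 0"] \<rho>[OF that, of 0] by simp
  have "0 \<le> c" using lc s0 by (intro LIMSEQ_le_const) (auto simp: less_imp_le)
  moreover have "\<not> 0 < c"
  proof
    assume c: "0 < c"
    \<comment> \<open>Since \<open>w \<le> 1\<close>, half of \<open>c\<close> pays for lowering the
      rate by \<open>\<delta>\<close> and the other half remains as slack; the second term of the
      minimum keeps the rate above \<open>1\<close>.\<close>
    define \<delta> where "\<delta> = min (c / 2) ((exp h - 1) / 2)"
    have \<delta>: "0 < \<delta>" "\<delta> \<le> c / 2" "1 < exp h - \<delta>" using c eh by (auto simp: \<delta>_def min_def field_simps)
    have "(\<Sum>e<d. w (\<tau> e)) + c / 2 \<le> (exp h - \<delta>) * w u" if "u \<in> P" "\<tau> \<in> T u" for u \<tau>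
    proof -
      have "\<delta> * w u \<le> c / 2 * 1" using \<delta> w1 w0 c by (intro mult_mono) auto
      then show ?thesis using wle[OF that] by (simp add: algebra_simps)
    qed
    then obtain K where "0 \<le> K" "\<forall>n. \<forall>u\<in>I. y n u \<le> K * (exp h - \<delta>) ^ n"
      using growth_le_supersolution[OF \<delta>(3), of "c / 2" w] c w0 by auto
    then have "h \<le> ln (exp h - \<delta>)" using rate_le_of_bound[OF two lim \<delta>(3)] by blast
    moreover have "ln (exp h - \<delta>) < ln (exp h)" using \<delta> by (subst ln_less_cancel_iff) auto
    ultimately show False by simp
  qed
  ultimately have "c = 0" by simp
  then show ?thesis
    using w0 wa weq \<rho>T by (intro exI[of _ w] exI[of _ \<rho>]) (auto simp: w_def)
qed

text \<open>The matrix on the support \<open>J\<close> of \<open>w\<close> counts the children of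
  each state under the fixed choice \<open>\<pi>\<close>. Children outside \<open>J\<close> have
  weight zero, so the eigenvalue equation survives the restriction.\<close>

theorem positive_eigenvalue_exp_rate:
  assumes two: "\<forall>\<^sub>F n in sequentially. 2 \<le> total n"
    and lim: "(\<lambda>n. ln (ln (real (total n))) / real n) \<longlonglongrightarrow> h" and h: "h > 0"
  shows "positive_eigenvalue (exp h)"
proof -
  obtain w \<pi> where w0: "\<And>u. 0 \<le> w u" and wout: "\<And>u. u \<notin> P \<Longrightarrow> w u = 0" and w1: "\<exists>u\<in>P. w u = 1"
    and weq: "\<And>u. u \<in> P \<Longrightarrow> (\<Sum>e<d. w (\<pi> u e)) = exp h * w u"
    using ex_optimal_eigenvector[OF assms] by blast
  define J where "J = {u \<in> P. w u \<noteq> 0}"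
  show ?thesis
  proof (rule positive_eigenvalueI[of J w])
    show fin: "finite J" using finP by (simp add: J_def)
    show "J \<noteq> {}" using w1 by (auto simp: J_def)
    show "0 < w u" if "u \<in> J" for u using that w0[of u] by (simp add: J_def less_le)
    show "(\<Sum>j\<in>J. real (card {e \<in> {..<d}. \<pi> u e = j}) * w j) = exp h * w u" if "u \<in> J" for u
      using sum_card_fibres[of "{..<d}" J "\<pi> u" w] fin wout weq[of u] that by (auto simp: J_def)
  qed
qed

end

section \<open>Blocks of a tree-shift of finite type\<close>

lemma Nil_in_words [simp]: "[] \<in> words d"
  by (simp add: words_def)

lemma Cons_in_words [simp]: "e # w \<in> words d \<longleftrightarrow> e < d \<and> w \<in> words d"
  by (auto simp: words_def)

lemma append_in_words [simp]: "v @ w \<in> words d \<longleftrightarrow> v \<in> words d \<and> w \<in> words d"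
  by (auto simp: words_def)

definition top_block :: "nat \<Rightarrow> nat \<Rightarrow> (nat list \<Rightarrow> 'a) \<Rightarrow> nat list \<rightharpoonup> 'a" where
  "top_block d n t w = (if w \<in> words d \<and> length w < n then Some (t w) else None)"

text \<open>Restricting to \<open>words d\<close> here and in \<open>node\<close> yields elements of
  the extensional function space \<open>trees\<close>.\<close>

definition subtree :: "nat \<Rightarrow> (nat list \<Rightarrow> 'a) \<Rightarrow> nat list \<Rightarrow> nat list \<Rightarrow> 'a" where
  "subtree d t v = restrict (\<lambda>w. t (v @ w)) (words d)"

definition node :: "nat \<Rightarrow> 'a \<Rightarrow> (nat \<Rightarrow> nat list \<Rightarrow> 'a) \<Rightarrow> nat list \<Rightarrow> 'a" where
  "node d a s = restrict (\<lambda>w. case w of [] \<Rightarrow> a | e # v \<Rightarrow> s e v) (words d)"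

lemma dom_top_block: "dom (top_block d n t) = (\<Union>j<n. {w \<in> words d. length w = j})"
  by (auto simp: top_block_def dom_def)

lemma finite_words_shorter: "finite (\<Union>j<n. {w \<in> words d. length w = j})"
  using finite_lists_length_le[of "{..<d}" n]
  by (rule finite_subset[rotated]) (auto simp: words_def)

lemma treesD: "t \<in> trees d A \<Longrightarrow> w \<in> words d \<Longrightarrow> t w \<in> A"
  by (auto simp: trees_def)

lemma subtree_in_trees: "t \<in> trees d A \<Longrightarrow> v \<in> words d \<Longrightarrow> subtree d t v \<in> trees d A"
  by (auto simp: trees_def subtree_def)

lemma node_in_trees: "a \<in> A \<Longrightarrow> (\<And>e. e < d \<Longrightarrow> s e \<in> trees d A) \<Longrightarrow> node d a s \<in> trees d A"
  by (fastforce simp: trees_def node_def split: list.split)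

lemma subtree_node:
  assumes "e < d" "s e \<in> trees d A"
  shows "subtree d (node d a s) [e] = s e"
  using assms by (auto simp: subtree_def node_def trees_def fun_eq_iff PiE_def extensional_def)

lemma top_block_in_blocks:
  assumes "t \<in> trees d A"
  shows "top_block d n t \<in> blocks d A n"
proof -
  have "prefix_closed (dom (top_block d n t))"
    by (auto simp: prefix_closed_def top_block_def dom_def prefix_def)
  moreover have "ran (top_block d n t) \<subseteq> A"
    using assms by (auto simp: ran_def top_block_def split: if_splits intro: treesD)
  moreover have "finite (dom (top_block d n t))"
    unfolding dom_top_block by (rule finite_words_shorter)
  ultimately show ?thesis unfolding blocks_def patterns_def using dom_top_block[of d n t] by auto
qed

text \<open>A pattern of \<open>F\<close> sees a node and at most \<open>k\<close> levels below it.
  The condition \<open>1 \<le> k\<close> makes a top block of height \<open>k\<close> contain the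
  root letter.\<close>

locale bounded_tree_shift =
  fixes d :: nat and A :: "'a set" and F :: "(nat list \<rightharpoonup> 'a) set" and k :: nat
  assumes finA: "finite A" and F: "F \<subseteq> patterns d A" and k: "1 \<le> k"
    and F_length: "u \<in> F \<Longrightarrow> w \<in> dom u \<Longrightarrow> length w \<le> k"
begin

abbreviation "X \<equiv> tree_shift d A F"

lemma X_trees: "t \<in> X \<Longrightarrow> t \<in> trees d A"
  by (simp add: tree_shift_def)

lemma dom_F: "u \<in> F \<Longrightarrow> dom u \<subseteq> words d"
  using F by (auto simp: patterns_def)

lemma pattern_of_subtree:
  assumes "u \<in> F" "v \<in> words d" "pattern_of d u (subtree d t v)"
  shows "pattern_of d u t"
proof -
  obtain x where x: "x \<in> words d" "\<And>y. y \<in> dom u \<Longrightarrow> u y = Some (subtree d t v (x @ y))"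
    using assms(3) by (auto simp: pattern_of_def)
  have "u y = Some (t ((v @ x) @ y))" if "y \<in> dom u" for y
    using x(2)[OF that] x(1) dom_F[OF assms(1)] that by (auto simp: subtree_def)
  then show ?thesis unfolding pattern_of_def using x(1) assms(2) by (intro bexI[of _ "v @ x"]) auto
qed

lemma subtree_in_X: "t \<in> X \<Longrightarrow> v \<in> words d \<Longrightarrow> subtree d t v \<in> X"
  using pattern_of_subtree by (auto simp: tree_shift_def subtree_in_trees)

text \<open>A block occurring at node \<open>x\<close> is the top block of the subtree at
  \<open>x\<close>, and this subtree again avoids \<open>F\<close>.\<close>

lemma blocks_of_eq: "blocks_of d A n X = top_block d n ` X"
proof (intro equalityI subsetI)
  fix u assume "u \<in> blocks_of d A n X"
  then obtain t x where t: "t \<in> X" "x \<in> words d" "\<And>y. y \<in> dom u \<Longrightarrow> u y = Some (t (x @ y))"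
    and dom: "dom u = (\<Union>j<n. {w \<in> words d. length w = j})"
    by (auto simp: blocks_of_def blocks_def pattern_of_def)
  have "u y = top_block d n (subtree d t x) y" for y
  proof (cases "y \<in> dom u")
    case True
    then show ?thesis using t(3)[OF True] dom by (auto simp: top_block_def subtree_def)
  next
    case False
    then have "y \<notin> dom (top_block d n (subtree d t x))" unfolding dom_top_block dom .
    then show ?thesis using False by (simp add: domIff)
  qed
  then show "u \<in> top_block d n ` X" using subtree_in_X[OF t(1,2)] by blast
next
  fix u assume "u \<in> top_block d n ` X"
  then obtain t where t: "t \<in> X" "u = top_block d n t" by blast
  have "pattern_of d u t"
    unfolding pattern_of_def t(2) by (rule bexI[of _ "[]"]) (auto simp: top_block_def split: if_splits)
  then show "u \<in> blocks_of d A n X"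
    using t top_block_in_blocks[OF X_trees] by (auto simp: blocks_of_def)
qed

lemma finite_top_blocks: "finite (top_block d n ` X)"
proof (rule finite_subset)
  show "top_block d n ` X \<subseteq> {u. dom u = (\<Union>j<n. {w \<in> words d. length w = j}) \<and> ran u \<subseteq> A}"
  proof
    fix u assume "u \<in> top_block d n ` X"
    then have "u \<in> blocks d A n" using top_block_in_blocks[OF X_trees] by blast
    then show "u \<in> {u. dom u = (\<Union>j<n. {w \<in> words d. length w = j}) \<and> ran u \<subseteq> A}"
      unfolding blocks_def patterns_def by blast
  qed
  show "finite {u :: nat list \<rightharpoonup> 'a. dom u = (\<Union>j<n. {w \<in> words d. length w = j}) \<and> ran u \<subseteq> A}"
    using finite_words_shorter finA by (rule finite_set_of_finite_maps)
qed

text \<open>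
  Since patterns of \<open>F\<close> have height at most \<open>k + 1\<close>, subtrees can be exchanged for others with
  the same top block of height \<open>k\<close>.
\<close>

lemma node_in_X:
  assumes t: "t \<in> X" and s: "\<And>e. e < d \<Longrightarrow> s e \<in> X"
    and top: "\<And>e. e < d \<Longrightarrow> top_block d k (s e) = top_block d k (subtree d t [e])"
  shows "node d (t []) s \<in> X" "top_block d k (node d (t []) s) = top_block d k t"
proof -
  let ?t = "node d (t []) s"
  have trees: "?t \<in> trees d A"
    by (intro node_in_trees treesD[OF X_trees[OF t]] X_trees s) simp_all
  \<comment> \<open>Blocks of height \<open>k\<close> at the children reach depth \<open>k\<close>
    in the whole tree, as deep as a pattern placed at the root can see. A pattern placed lower lies
    inside one of the \<open>s e\<close>.\<close>
  have eq: "?t w = t w" if w: "w \<in> words d" "length w \<le> k" for w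
  proof (cases w)
    case Nil
    then show ?thesis by (simp add: node_def)
  next
    case (Cons e v)
    then have v: "e < d" "v \<in> words d" "length v < k" using w by auto
    from fun_cong[OF top[OF v(1)], of v] v show ?thesis
      by (simp add: Cons node_def top_block_def subtree_def)
  qed
  then show "top_block d k ?t = top_block d k t" by (auto simp: top_block_def fun_eq_iff)
  have "\<not> pattern_of d u ?t" if u: "u \<in> F" for u
  proof
    assume "pattern_of d u ?t"
    then obtain x where x: "x \<in> words d" "\<And>y. y \<in> dom u \<Longrightarrow> u y = Some (?t (x @ y))"
      by (auto simp: pattern_of_def)
    show False
    proof (cases x)
      case Nil
      have "u y = Some (t ([] @ y))" if "y \<in> dom u" for y
        using x(2)[OF that] eq[of y] dom_F[OF u] F_length[OF u that] that by (auto simp: Nil)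
      then have "pattern_of d u t" unfolding pattern_of_def by (intro bexI[of _ "[]"]) auto
      then show False using t u by (auto simp: tree_shift_def)
    next
      case (Cons e v)
      then have v: "e < d" "v \<in> words d" using x(1) by auto
      have "u y = Some (s e (v @ y))" if "y \<in> dom u" for y
        using x(2)[OF that] v dom_F[OF u] that by (auto simp: Cons node_def)
      then have "pattern_of d u (s e)" unfolding pattern_of_def using v(2) by blast
      then show False using s[OF v(1)] u by (auto simp: tree_shift_def)
    qed
  qed
  then show "?t \<in> X" using trees by (simp add: tree_shift_def)
qed

section \<open>Counting the extensions of a top block\<close>

definition children :: "(nat list \<Rightarrow> 'a) \<Rightarrow> nat \<Rightarrow> nat list \<rightharpoonup> 'a" where
  "children t = restrict (\<lambda>e. top_block d k (subtree d t [e])) {..<d}"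

definition child_tops :: "(nat list \<rightharpoonup> 'a) \<Rightarrow> (nat \<Rightarrow> nat list \<rightharpoonup> 'a) set" where
  "child_tops u = children ` {t \<in> X. top_block d k t = u}"

definition extensions :: "nat \<Rightarrow> (nat list \<rightharpoonup> 'a) \<Rightarrow> (nat list \<rightharpoonup> 'a) set" where
  "extensions n u = top_block d (k + n) ` {t \<in> X. top_block d k t = u}"

lemma finite_extensions: "finite (extensions n u)"
  using finite_top_blocks unfolding extensions_def by (rule finite_subset[rotated]) auto

lemma extensions_top:
  assumes "b \<in> extensions n u" "b \<in> extensions n u'"
  shows "u = u'"
proof -
  have "u w = (if length w < k then b w else None)" if "b \<in> extensions n u" for u w
    using that by (auto simp: extensions_def top_block_def)
  from this[OF assms(1)] this[OF assms(2)] show ?thesis by (simp add: fun_eq_iff)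
qed

lemma child_tops_in: "\<tau> \<in> child_tops u \<Longrightarrow> \<tau> \<in> {..<d} \<rightarrow>\<^sub>E top_block d k ` X"
  by (auto simp: child_tops_def children_def intro!: imageI subtree_in_X)

lemma top_block_Cons:
  "e < d \<Longrightarrow> top_block d (Suc n) t (e # w) = top_block d n (subtree d t [e]) w"
  by (auto simp: top_block_def subtree_def)

text \<open>The root letter is determined by \<open>u\<close>, so only the blocks below the children
  remain. Once their tops form an admissible tuple, the exchange of subtrees makes these blocks
  independent, hence the product.\<close>

lemma extensions_Suc:
  "bij_betw (\<lambda>b. restrict (\<lambda>e w. b (e # w)) {..<d}) (extensions (Suc n) u)
    (\<Union>\<tau>\<in>child_tops u. (\<Pi>\<^sub>E e\<in>{..<d}. extensions n (\<tau> e)))"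
  (is "bij_betw ?\<Phi> _ _")
proof (rule bij_betw_imageI)
  have child: "?\<Phi> (top_block d (k + Suc n) t) = restrict (\<lambda>e. top_block d (k + n) (subtree d t [e])) {..<d}" for t
    by (auto simp: top_block_Cons restrict_def fun_eq_iff)
  show "inj_on ?\<Phi> (extensions (Suc n) u)"
  proof (rule inj_onI)
    fix b b' assume b: "b \<in> extensions (Suc n) u" "b' \<in> extensions (Suc n) u" "?\<Phi> b = ?\<Phi> b'"
    show "b = b'"
    proof
      fix w show "b w = b' w"
      proof (cases w)
        case Nil
        have u: "b [] = u []" if "b \<in> extensions (Suc n) u" for b
          using that k by (auto simp: extensions_def top_block_def)
        show ?thesis unfolding Nil u[OF b(1)] u[OF b(2)] ..
      next
        case (Cons e v)
        show ?thesis
        proof (cases "e < d")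
          case True
          then show ?thesis using fun_cong[OF fun_cong[OF b(3), of e], of v] by (simp add: Cons)
        next
          case False
          have u: "b w = None" if "b \<in> extensions (Suc n) u" for b
            using that False by (auto simp: extensions_def top_block_def Cons)
          show ?thesis unfolding u[OF b(1)] u[OF b(2)] ..
        qed
      qed
    qed
  qed
  show "?\<Phi> ` extensions (Suc n) u = (\<Union>\<tau>\<in>child_tops u. (\<Pi>\<^sub>E e\<in>{..<d}. extensions n (\<tau> e)))"
  proof (intro equalityI subsetI)
    fix g assume "g \<in> ?\<Phi> ` extensions (Suc n) u"
    then obtain t where t: "t \<in> X" "top_block d k t = u"
      and g: "g = restrict (\<lambda>e. top_block d (k + n) (subtree d t [e])) {..<d}"
      unfolding extensions_def image_image child by blast
    have "children t \<in> child_tops u" using t by (auto simp: child_tops_def)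
    moreover have "g \<in> (\<Pi>\<^sub>E e\<in>{..<d}. extensions n (children t e))"
      using subtree_in_X[OF t(1)] by (auto simp: g extensions_def children_def)
    ultimately show "g \<in> (\<Union>\<tau>\<in>child_tops u. (\<Pi>\<^sub>E e\<in>{..<d}. extensions n (\<tau> e)))" by blast
  next
    fix g assume "g \<in> (\<Union>\<tau>\<in>child_tops u. (\<Pi>\<^sub>E e\<in>{..<d}. extensions n (\<tau> e)))"
    then obtain t where t: "t \<in> X" "top_block d k t = u"
      and g: "g \<in> (\<Pi>\<^sub>E e\<in>{..<d}. extensions n (children t e))" by (auto simp: child_tops_def)
    have "\<exists>s\<in>X. top_block d k s = top_block d k (subtree d t [e]) \<and> g e = top_block d (k + n) s"
      if "e < d" for e
      using PiE_mem[OF g, of e] that by (auto simp: extensions_def children_def)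
    then obtain s where s: "\<And>e. e < d \<Longrightarrow> s e \<in> X"
      "\<And>e. e < d \<Longrightarrow> top_block d k (s e) = top_block d k (subtree d t [e])"
      "\<And>e. e < d \<Longrightarrow> g e = top_block d (k + n) (s e)" by metis
    note t' = node_in_X[OF t(1) s(1,2)]
    have "g = restrict (\<lambda>e. top_block d (k + n) (subtree d (node d (t []) s) [e])) {..<d}"
    proof
      fix e show "g e = restrict (\<lambda>e. top_block d (k + n) (subtree d (node d (t []) s) [e])) {..<d} e"
        using s(3)[of e] subtree_node[OF _ X_trees[OF s(1)], of e] PiE_arb[OF g, of e]
        by (cases "e < d") auto
    qed
    then show "g \<in> ?\<Phi> ` extensions (Suc n) u"
      unfolding extensions_def image_image child using t' t(2) by blast
  qed
qed

text \<open>A block of height \<open>k + n\<close> determines its top of height \<open>k\<close>, so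
  distinct tuples give disjoint products and the cardinalities add up.\<close>

sublocale tree_recursion "top_block d k ` X" d child_tops "\<lambda>n u. card (extensions n u)"
proof
  show "finite (top_block d k ` X)" by (rule finite_top_blocks)
next
  fix u assume "u \<in> top_block d k ` X"
  then show "child_tops u \<noteq> {}" "card (extensions 0 u) = 1"
  proof -
    assume "u \<in> top_block d k ` X"
    then obtain t where "t \<in> X" "top_block d k t = u" by blast
    then have "extensions 0 u = {u}" "child_tops u \<noteq> {}" by (auto simp: extensions_def child_tops_def)
    then show "child_tops u \<noteq> {}" "card (extensions 0 u) = 1" by simp_all
  qed
  have "finite ({..<d} \<rightarrow>\<^sub>E top_block d k ` X)" by (intro finite_PiE finite_top_blocks) auto
  then show fin: "finite (child_tops u)" by (rule finite_subset[rotated]) (auto dest: child_tops_in)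
  show "\<tau> e \<in> top_block d k ` X" if "\<tau> \<in> child_tops u" "e < d" for \<tau> e
    using child_tops_in[OF that(1)] that(2) by auto
  fix n
  have "card (extensions (Suc n) u) = card (\<Union>\<tau>\<in>child_tops u. (\<Pi>\<^sub>E e\<in>{..<d}. extensions n (\<tau> e)))"
    using extensions_Suc by (rule bij_betw_same_card)
  also have "\<dots> = (\<Sum>\<tau>\<in>child_tops u. card (\<Pi>\<^sub>E e\<in>{..<d}. extensions n (\<tau> e)))"
  proof (rule card_UN_disjoint[OF fin])
    show "\<forall>\<tau>\<in>child_tops u. finite (\<Pi>\<^sub>E e\<in>{..<d}. extensions n (\<tau> e))"
      by (auto intro!: finite_PiE finite_extensions)
    show "\<forall>\<tau>\<in>child_tops u. \<forall>\<tau>'\<in>child_tops u. \<tau> \<noteq> \<tau>' \<longrightarrow>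
      (\<Pi>\<^sub>E e\<in>{..<d}. extensions n (\<tau> e)) \<inter> (\<Pi>\<^sub>E e\<in>{..<d}. extensions n (\<tau>' e)) = {}"
    proof (intro ballI impI, rule ccontr)
      fix \<tau> \<tau>' assume \<tau>: "\<tau> \<in> child_tops u" "\<tau>' \<in> child_tops u" "\<tau> \<noteq> \<tau>'"
        and "(\<Pi>\<^sub>E e\<in>{..<d}. extensions n (\<tau> e)) \<inter> (\<Pi>\<^sub>E e\<in>{..<d}. extensions n (\<tau>' e)) \<noteq> {}"
      then obtain g where g: "g \<in> (\<Pi>\<^sub>E e\<in>{..<d}. extensions n (\<tau> e))" "g \<in> (\<Pi>\<^sub>E e\<in>{..<d}. extensions n (\<tau>' e))" by blast
      have "\<tau> e = \<tau>' e" if "e \<in> {..<d}" for e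
        using extensions_top[of "g e" n "\<tau> e" "\<tau>' e"] PiE_mem[OF g(1) that] PiE_mem[OF g(2) that] by simp
      then have "\<tau> = \<tau>'" by (rule PiE_ext[OF child_tops_in[OF \<tau>(1)] child_tops_in[OF \<tau>(2)]])
      then show False using \<tau>(3) by simp
    qed
  qed
  also have "\<dots> = (\<Sum>\<tau>\<in>child_tops u. \<Prod>e<d. card (extensions n (\<tau> e)))"
    by (simp add: card_PiE)
  finally show "card (extensions (Suc n) u) = (\<Sum>\<tau>\<in>child_tops u. \<Prod>e<d. card (extensions n (\<tau> e)))" .
qed

lemma card_blocks_of: "card (blocks_of d A (k + n) X) = total n"
proof -
  have "blocks_of d A (k + n) X = (\<Union>u\<in>top_block d k ` X. extensions n u)"
    unfolding blocks_of_eq by (auto simp: extensions_def)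
  also have "card \<dots> = total n"
    unfolding total_def using finite_top_blocks finite_extensions extensions_top
    by (intro card_UN_disjoint) blast+
  finally show ?thesis .
qed

end

lemma tree_SFT_bounded:
  assumes "tree_SFT d A X" "finite A"
  obtains F k where "X = tree_shift d A F" "bounded_tree_shift d A F k"
proof -
  obtain F where F: "finite F" "F \<subseteq> patterns d A" "X = tree_shift d A F"
    using assms(1) by (auto simp: tree_SFT_def)
  \<comment> \<open>The sum is a crude common bound on the lengths; \<open>Suc\<close> ensures
    \<open>1 \<le> k\<close>.\<close>
  define k where "k = Suc (\<Sum>w\<in>(\<Union>u\<in>F. dom u). length w)"
  have "finite (\<Union>u\<in>F. dom u)" using F by (auto simp: patterns_def)
  then have "length w \<le> k" if "u \<in> F" "w \<in> dom u" for u w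
  proof -
    have "w \<in> (\<Union>u\<in>F. dom u)" using that by blast
    then have "length w \<le> (\<Sum>w\<in>(\<Union>u\<in>F. dom u). length w)"
      using \<open>finite (\<Union>u\<in>F. dom u)\<close> by (intro member_le_sum) auto
    then show ?thesis by (simp add: k_def)
  qed
  then have "bounded_tree_shift d A F k"
    using F assms(2) by unfold_locales (auto simp: k_def)
  then show ?thesis using F(3) that by blast
qed

theorem entropy_cases:
  assumes "tree_SFT d A X" "finite A" "has_entropy d A X h"
  shows "h = 0 \<or> 0 < h \<and> positive_eigenvalue (exp h)"
proof -
  obtain F k where X: "X = tree_shift d A F" and "bounded_tree_shift d A F k"
    using tree_SFT_bounded[OF assms(1,2)] by blast
  then interpret bounded_tree_shift d A F k by simp
  define c where "c n = card (blocks_of d A n X)" for n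
  have ctot: "c (n + k) = total n" for n
    using card_blocks_of[of n] by (simp add: c_def X add.commute)
  have two: "\<forall>\<^sub>F n in sequentially. 2 \<le> c n"
    and lim: "(\<lambda>n. ln (ln (real (c n))) / real n) \<longlonglongrightarrow> h"
    using assms(3) by (auto simp: has_entropy_def c_def)
  have two': "\<forall>\<^sub>F n in sequentially. 2 \<le> total n"
    using sequentially_offset[OF two, of k] by (simp add: ctot)
  have "(\<lambda>n. ln (ln (real (c (n + k)))) / real (n + k)) \<longlonglongrightarrow> h"
    by (rule LIMSEQ_ignore_initial_segment[OF lim])
  moreover have "(\<lambda>n. real (n + k) / real n) \<longlonglongrightarrow> 1"
  proof -
    have "(\<lambda>n. 1 + real k / real n) \<longlonglongrightarrow> 1 + 0"
      by (intro tendsto_add tendsto_const lim_const_over_n)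
    moreover have "\<forall>\<^sub>F n in sequentially. 1 + real k / real n = real (n + k) / real n"
      using eventually_gt_at_top[of 0] by eventually_elim (simp add: field_simps)
    ultimately have "(\<lambda>n. real (n + k) / real n) \<longlonglongrightarrow> 1 + 0" by (rule Lim_transform_eventually)
    then show ?thesis by simp
  qed
  ultimately have "(\<lambda>n. ln (ln (real (c (n + k)))) / real (n + k) * (real (n + k) / real n)) \<longlonglongrightarrow> h * 1"
    by (rule tendsto_mult)
  moreover have "\<forall>\<^sub>F n in sequentially. ln (ln (real (c (n + k)))) / real (n + k) * (real (n + k) / real n)
      = ln (ln (real (total n))) / real n"
    using eventually_gt_at_top[of 0] by eventually_elim (simp add: ctot)
  ultimately have "(\<lambda>n. ln (ln (real (total n))) / real n) \<longlonglongrightarrow> h * 1"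
    by (rule Lim_transform_eventually)
  then have lim': "(\<lambda>n. ln (ln (real (total n))) / real n) \<longlonglongrightarrow> h" by simp
  \<comment> \<open>At least two blocks force the quotient above \<open>ln (ln 2) / n\<close>, which
    tends to \<open>0\<close>.\<close>
  have "h \<ge> 0"
  proof (rule LIMSEQ_le[OF lim_const_over_n[of "ln (ln 2)"] lim'])
    obtain N where N: "\<And>n. n \<ge> N \<Longrightarrow> 2 \<le> total n" using two' by (auto simp: eventually_sequentially)
    have "ln (ln 2) / real n \<le> ln (ln (real (total n))) / real n" if "n \<ge> N" for n
      using N[OF that] by (intro divide_right_mono ln_mono) auto
    then show "\<exists>N. \<forall>n\<ge>N. ln (ln 2) / real n \<le> ln (ln (real (total n))) / real n" by blast
  qed
  then show ?thesis using positive_eigenvalue_exp_rate[OF two' lim'] by force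
qed

section \<open>Realisation of the entropies\<close>

text \<open>The fibres are laid out as consecutive intervals and \<open>0\<close> takes all
  remaining positions. The induction also carries that \<open>g\<close> vanishes from the partial
  sum on, which leaves room for the next interval.\<close>

lemma ex_fun_with_fibres:
  fixes c :: "nat \<Rightarrow> nat"
  assumes "(\<Sum>j<m. c j) \<le> D"
  shows "\<exists>g. (\<forall>e. g e \<le> m) \<and> (\<forall>j<m. card {e \<in> {..<D}. g e = Suc j} = c j)"
proof -
  have "\<exists>g. (\<forall>e. g e \<le> m) \<and> (\<forall>e\<ge>(\<Sum>j<m. c j). g e = 0) \<and>
    (\<forall>j<m. card {e \<in> {..<D}. g e = Suc j} = c j)"
    using assms
  proof (induction m)
    case 0
    show ?case by (rule exI[of _ "\<lambda>_. 0"]) simp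
  next
    case (Suc m)
    define s where "s = (\<Sum>j<m. c j)"
    have sD: "s + c m \<le> D" using Suc.prems by (simp add: s_def)
    then obtain g where g: "\<And>e. g e \<le> m" "\<And>e. s \<le> e \<Longrightarrow> g e = 0"
      "\<And>j. j < m \<Longrightarrow> card {e \<in> {..<D}. g e = Suc j} = c j"
      using Suc.IH by (auto simp: s_def)
    define g' where "g' e = (if s \<le> e \<and> e < s + c m then Suc m else g e)" for e
    have "card {e \<in> {..<D}. g' e = Suc j} = c j" if "j < Suc m" for j
    proof (cases "j = m")
      case True
      have "g e \<noteq> Suc m" for e using g(1)[of e] by simp
      then have "{e \<in> {..<D}. g' e = Suc j} = {s..<s + c m}"
        using sD by (auto simp: g'_def True)
      then show ?thesis by (simp add: True)
    next
      case False
      then have "{e \<in> {..<D}. g' e = Suc j} = {e \<in> {..<D}. g e = Suc j}"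
        using g(2) by (auto simp: g'_def)
      then show ?thesis using g(3)[of j] False that by simp
    qed
    moreover have "g' e \<le> Suc m" for e using g(1)[of e] by (simp add: g'_def)
    moreover have "g' e = 0" if "s + c m \<le> e" for e using g(2)[of e] that by (simp add: g'_def)
    ultimately show ?case by (intro exI[of _ g']) (simp add: s_def)
  qed
  then show ?thesis by blast
qed

text \<open>
  Letters carry a state: letter \<open>0\<close> is a filler (state \<open>0\<close>) and letters \<open>2 j + 1\<close>, \<open>2 j + 2\<close> are
  two copies of state \<open>j + 1\<close>. The state of a node determines the states of its children by \<open>G\<close>,
  whereas the copies are chosen freely.
\<close>

definition letter_state :: "nat \<Rightarrow> nat" where
  "letter_state a = (a + 1) div 2"

definition state_patterns :: "nat \<Rightarrow> nat \<Rightarrow> (nat \<Rightarrow> nat \<Rightarrow> nat) \<Rightarrow> (nat list \<rightharpoonup> nat) set" where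
  "state_patterns d m G = (\<lambda>(a, b, e). [[] \<mapsto> a, [e] \<mapsto> b]) `
    {(a, b, e). a < Suc (2 * m) \<and> b < Suc (2 * m) \<and> e < d \<and> letter_state b \<noteq> G (letter_state a) e}"

definition state_weight :: "nat \<Rightarrow> nat" where
  "state_weight s = (if s = 0 then 1 else 2)"

text \<open>The number of blocks of height \<open>n + 1\<close> whose root is a given letter of
  state \<open>s\<close>: each child chooses a copy of its state and continues
  independently.\<close>

fun state_count :: "nat \<Rightarrow> (nat \<Rightarrow> nat \<Rightarrow> nat) \<Rightarrow> nat \<Rightarrow> nat \<Rightarrow> nat" where
  "state_count d G 0 s = 1"
| "state_count d G (Suc n) s = (\<Prod>e<d. state_weight (G s e) * state_count d G n (G s e))"

lemma letter_state_le: "a < Suc (2 * m) \<Longrightarrow> letter_state a \<le> m"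
  by (simp add: letter_state_def)

lemma letters_of_state:
  assumes "s \<le> m"
  shows "card {b. b < Suc (2 * m) \<and> letter_state b = s} = state_weight s"
proof (cases s)
  case 0
  have "{b. b < Suc (2 * m) \<and> letter_state b = s} = {0}" by (auto simp: 0 letter_state_def)
  then show ?thesis by (simp add: state_weight_def 0)
next
  case (Suc j)
  have "{b. b < Suc (2 * m) \<and> letter_state b = s} = {2 * j + 1, 2 * j + 2}"
    using assms by (auto simp: Suc letter_state_def)
  then show ?thesis by (simp add: state_weight_def Suc)
qed

section \<open>Block counts of the shift with deterministic states\<close>

locale state_tree_shift =
  fixes d m :: nat and G :: "nat \<Rightarrow> nat \<Rightarrow> nat"
  assumes G_le: "s \<le> m \<Longrightarrow> G s e \<le> m"
begin

abbreviation "A \<equiv> {..<Suc (2 * m)}"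
abbreviation "F \<equiv> state_patterns d m G"

sublocale bounded_tree_shift d A F "Suc 0"
proof
  show "finite A" by simp
  show "F \<subseteq> patterns d A"
  proof
    fix u assume "u \<in> F"
    then obtain a b e where u: "u = [[] \<mapsto> a, [e] \<mapsto> b]" "a < Suc (2 * m)" "b < Suc (2 * m)" "e < d"
      by (auto simp: state_patterns_def)
    then have "prefix_closed (dom u)" by (auto simp: prefix_closed_def prefix_Cons)
    then show "u \<in> patterns d A" using u by (auto simp: patterns_def ran_def)
  qed
  show "length w \<le> Suc 0" if "u \<in> F" "w \<in> dom u" for u w
    using that by (auto simp: state_patterns_def split: if_splits)
qed simp

lemma in_shift_iff:
  "t \<in> X \<longleftrightarrow> t \<in> trees d A \<and>
    (\<forall>x\<in>words d. \<forall>e<d. letter_state (t (x @ [e])) = G (letter_state (t x)) e)"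
proof (cases "t \<in> trees d A")
  case True
  have "(\<exists>u\<in>F. pattern_of d u t) \<longleftrightarrow>
      (\<exists>x\<in>words d. \<exists>e<d. letter_state (t (x @ [e])) \<noteq> G (letter_state (t x)) e)"
  proof
    assume "\<exists>u\<in>F. pattern_of d u t"
    then obtain a b e x where abe: "a < Suc (2 * m)" "b < Suc (2 * m)" "e < d"
      "letter_state b \<noteq> G (letter_state a) e" "x \<in> words d"
      and eq: "\<forall>y\<in>dom [[] \<mapsto> a, [e] \<mapsto> b]. [[] \<mapsto> a, [e] \<mapsto> b] y = Some (t (x @ y))"
      by (auto simp: state_patterns_def pattern_of_def)
    have "t x = a" "t (x @ [e]) = b" using eq by auto
    then show "\<exists>x\<in>words d. \<exists>e<d. letter_state (t (x @ [e])) \<noteq> G (letter_state (t x)) e"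
      using abe by blast
  next
    assume "\<exists>x\<in>words d. \<exists>e<d. letter_state (t (x @ [e])) \<noteq> G (letter_state (t x)) e"
    then obtain x e where x: "x \<in> words d" "e < d" "letter_state (t (x @ [e])) \<noteq> G (letter_state (t x)) e"
      by blast
    let ?u = "[[] \<mapsto> t x, [e] \<mapsto> t (x @ [e])]"
    have "t x < Suc (2 * m)" "t (x @ [e]) < Suc (2 * m)" using treesD[OF True] x by auto
    then have "?u \<in> F" using x unfolding state_patterns_def by (intro image_eqI[of _ _ "(t x, t (x @ [e]), e)"]) auto
    moreover have "pattern_of d ?u t" unfolding pattern_of_def using x(1) by (intro bexI[of _ x]) auto
    ultimately show "\<exists>u\<in>F. pattern_of d u t" by blast
  qed
  then show ?thesis using True unfolding tree_shift_def by blast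
qed (simp add: tree_shift_def)

text \<open>A canonical tree with root letter \<open>a\<close>: every node below the root takes the
  letter \<open>2 * s\<close> of its prescribed state \<open>s\<close>. It witnesses that every
  letter occurs as a root.\<close>

primrec run :: "nat \<Rightarrow> nat list \<Rightarrow> nat" where
  "run a [] = a"
| "run a (e # w) = run (2 * G (letter_state a) e) w"

lemma letter_state_double [simp]: "letter_state (2 * s) = s"
  by (simp add: letter_state_def)

lemma run_lt: "a \<in> A \<Longrightarrow> run a w \<in> A"
proof (induction w arbitrary: a)
  case (Cons e w)
  have "2 * G (letter_state a) e \<in> A"
    using G_le[OF letter_state_le, of a e] Cons.prems by simp
  then show ?case using Cons.IH by simp
qed simp

lemma run_snoc: "letter_state (run a (w @ [e])) = G (letter_state (run a w)) e"
  by (induction w arbitrary: a) simp_all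

lemma run_in_X: "a \<in> A \<Longrightarrow> restrict (run a) (words d) \<in> X"
  using run_lt[of a] by (auto simp: in_shift_iff trees_def run_snoc)

definition root_block :: "nat \<Rightarrow> nat list \<rightharpoonup> nat" where
  "root_block a = [[] \<mapsto> a]"

lemma top_block_Suc_0: "top_block d (Suc 0) t = root_block (t [])"
  by (auto simp: top_block_def root_block_def fun_eq_iff)

lemma root_block_inj: "root_block a = root_block b \<longleftrightarrow> a = b"
  by (auto simp: root_block_def dest: fun_cong[of _ _ "[]"])

lemma root_blocks: "top_block d (Suc 0) ` X = root_block ` A"
proof (intro equalityI subsetI)
  fix u assume "u \<in> top_block d (Suc 0) ` X"
  then show "u \<in> root_block ` A" using treesD[OF X_trees, of _ "[]"] by (auto simp: top_block_Suc_0)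
next
  fix u assume "u \<in> root_block ` A"
  then obtain a where "a \<in> A" "u = root_block a" by blast
  then show "u \<in> top_block d (Suc 0) ` X"
    using run_in_X[of a] by (intro image_eqI[of _ _ "restrict (run a) (words d)"]) (simp_all add: top_block_Suc_0)
qed

text \<open>Grafting canonical trees below the root realises every choice of copies, so only the
  states of the children are constrained.\<close>

lemma child_tops_root_block:
  assumes a: "a \<in> A"
  shows "child_tops (root_block a) =
    (\<Pi>\<^sub>E e\<in>{..<d}. root_block ` {b. b < Suc (2 * m) \<and> letter_state b = G (letter_state a) e})"
proof (intro equalityI subsetI)
  fix \<tau> assume "\<tau> \<in> child_tops (root_block a)"
  then obtain t where t: "t \<in> X" "t [] = a" and \<tau>: "\<tau> = children t"
    by (auto simp: child_tops_def top_block_Suc_0 root_block_inj)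
  have "t [e] < Suc (2 * m) \<and> letter_state (t [e]) = G (letter_state a) e" if "e < d" for e
  proof
    show "t [e] < Suc (2 * m)" using treesD[OF X_trees[OF t(1)], of "[e]"] that by simp
    have "letter_state (t ([] @ [e])) = G (letter_state (t [])) e"
      using t(1) that Nil_in_words unfolding in_shift_iff by blast
    then show "letter_state (t [e]) = G (letter_state a) e" by (simp add: t(2))
  qed
  then show "\<tau> \<in> (\<Pi>\<^sub>E e\<in>{..<d}. root_block ` {b. b < Suc (2 * m) \<and> letter_state b = G (letter_state a) e})"
    by (auto simp: \<tau> children_def top_block_Suc_0 subtree_def)
next
  fix \<tau> assume \<tau>: "\<tau> \<in> (\<Pi>\<^sub>E e\<in>{..<d}. root_block ` {b. b < Suc (2 * m) \<and> letter_state b = G (letter_state a) e})"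
  have "\<exists>b. b < Suc (2 * m) \<and> letter_state b = G (letter_state a) e \<and> \<tau> e = root_block b" if "e < d" for e
    using PiE_mem[OF \<tau>, of e] that by auto
  then obtain b where b: "\<And>e. e < d \<Longrightarrow> b e < Suc (2 * m)"
    "\<And>e. e < d \<Longrightarrow> letter_state (b e) = G (letter_state a) e" "\<And>e. e < d \<Longrightarrow> \<tau> e = root_block (b e)"
    by metis
  define t where "t = node d a (\<lambda>e. restrict (run (b e)) (words d))"
  have sub: "restrict (run (b e)) (words d) \<in> X" if "e < d" for e
    using b(1)[OF that] by (intro run_in_X) simp
  have "t \<in> trees d A"
    unfolding t_def using a sub X_trees by (intro node_in_trees) auto
  moreover have "letter_state (t (x @ [e])) = G (letter_state (t x)) e" if "x \<in> words d" "e < d" for x e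
    using that b(2) by (cases x) (auto simp: t_def node_def run_snoc)
  ultimately have "t \<in> X" by (simp add: in_shift_iff)
  moreover have "t [] = a" by (simp add: t_def node_def)
  moreover have "children t = \<tau>"
  proof
    fix e show "children t e = \<tau> e"
      using b(3)[of e] PiE_arb[OF \<tau>, of e]
      by (cases "e < d") (auto simp: children_def top_block_Suc_0 subtree_def t_def node_def)
  qed
  ultimately show "\<tau> \<in> child_tops (root_block a)"
    by (auto simp: child_tops_def top_block_Suc_0 intro!: image_eqI[of _ _ t])
qed

text \<open>The admissible tuples form a product set, so the sum of products in the recursion
  factors into a product of sums, each with equal summands.\<close>

lemma card_extensions:
  "a \<in> A \<Longrightarrow> card (extensions n (root_block a)) = state_count d G n (letter_state a)"
proof (induction n arbitrary: a)
  case 0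
  then have "root_block a \<in> top_block d (Suc 0) ` X" by (simp only: root_blocks imageI)
  then show ?case by (simp only: x_0 state_count.simps)
next
  case (Suc n)
  let ?B = "\<lambda>e. {b. b < Suc (2 * m) \<and> letter_state b = G (letter_state a) e}"
  have I: "root_block a \<in> top_block d (Suc 0) ` X" using Suc.prems by (simp only: root_blocks imageI)
  have "card (extensions (Suc n) (root_block a))
      = (\<Sum>\<tau>\<in>(\<Pi>\<^sub>E e\<in>{..<d}. root_block ` ?B e). \<Prod>e<d. card (extensions n (\<tau> e)))"
    unfolding x_Suc[OF I] child_tops_root_block[OF Suc.prems] ..
  also have "\<dots> = (\<Prod>e<d. \<Sum>u\<in>root_block ` ?B e. card (extensions n u))"
    by (rule prod_sum_PiE[symmetric]) auto
  also have "\<dots> = (\<Prod>e<d. \<Sum>b\<in>?B e. card (extensions n (root_block b)))"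
    by (intro prod.cong refl sum.reindex[THEN trans]) (auto simp: inj_on_def root_block_inj)
  also have "\<dots> = (\<Prod>e<d. \<Sum>b\<in>?B e. state_count d G n (G (letter_state a) e))"
    using Suc.IH by (intro prod.cong sum.cong refl) auto
  also have "\<dots> = state_count d G (Suc n) (letter_state a)"
    using letters_of_state[OF G_le[OF letter_state_le]] Suc.prems by simp
  finally show ?case .
qed

lemma total_eq: "total n = (\<Sum>a\<in>A. state_count d G n (letter_state a))"
  unfolding total_def unfolding root_blocks using card_extensions
  by (subst sum.reindex) (auto simp: inj_on_def root_block_inj)

lemma card_blocks: "card (blocks_of d A (Suc n) X) = (\<Sum>a\<in>A. state_count d G n (letter_state a))"
  using card_blocks_of[of n] total_eq[of n] by simp

end

text \<open>The logarithmic counts \<open>z\<close> obey an affine recursion with matrix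
  \<open>M\<close> and constant \<open>ln 2\<close>. Comparison with the eigenvector
  \<open>w\<close> puts them between multiples of \<open>r ^ n\<close> and
  \<open>(n + 1) * r ^ n\<close>; the extra factor is invisible after the double logarithm and
  division by \<open>n\<close>.\<close>

lemma positive_eigenvalue_imp_entropy:
  assumes "positive_eigenvalue r" and r: "r \<ge> 1"
  shows "ln r \<in> tree_SFT_entropies"
proof -
  from assms(1) obtain m :: nat and M w where m: "m > 0"
    and w: "\<And>i. i < m \<Longrightarrow> 0 < w i"
    and Mw: "\<And>i. i < m \<Longrightarrow> (\<Sum>j<m. real (M i j) * w j) = r * w i"
    unfolding positive_eigenvalue_def by blast
  \<comment> \<open>Large enough for every row sum of \<open>M\<close>, the surplus children
    becoming fillers; \<open>Suc\<close> gives arity at least \<open>1\<close>.\<close>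
  define d where "d = Suc (\<Sum>i<m. \<Sum>j<m. M i j)"
  have "\<exists>g. (\<forall>e. g e \<le> m) \<and> (\<forall>j<m. card {e \<in> {..<d}. g e = Suc j} = M i j)" if "i < m" for i
  proof (rule ex_fun_with_fibres)
    have "(\<Sum>j<m. M i j) \<le> (\<Sum>i<m. \<Sum>j<m. M i j)"
      using that by (intro member_le_sum[of i "{..<m}" "\<lambda>i. \<Sum>j<m. M i j"]) auto
    then show "(\<Sum>j<m. M i j) \<le> d" by (simp add: d_def)
  qed
  then obtain g where g: "\<And>i e. i < m \<Longrightarrow> g i e \<le> m"
    "\<And>i j. i < m \<Longrightarrow> j < m \<Longrightarrow> card {e \<in> {..<d}. g i e = Suc j} = M i j" by metis
  define G where "G s e = (if s = 0 \<or> m < s then 0 else g (s - 1) e)" for s e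
  have GS: "G (Suc i) e = g i e" if "i < m" for i e using that by (simp add: G_def)
  interpret state_tree_shift d m G
  proof
    show "G s e \<le> m" for s e using g(1)[of "s - 1" e] by (auto simp: G_def)
  qed
  let ?c = "state_count d G"
  have c0: "?c n 0 = 1" for n
  proof (induction n)
    case (Suc n)
    have "G 0 e = 0" for e by (simp add: G_def)
    then show ?case using Suc by (simp add: state_weight_def)
  qed simp
  have c1: "1 \<le> ?c n s" for n s
  proof (induction n arbitrary: s)
    case (Suc n)
    have "1 \<le> state_weight (G s e) * ?c n (G s e)" for e
      using mult_le_mono[of 1 "state_weight (G s e)" 1 "?c n (G s e)"] Suc by (simp add: state_weight_def)
    then show ?case unfolding state_count.simps by (intro prod_ge_1)
  qed simp
  \<comment> \<open>The factor \<open>2\<close> counts the copies of the root state. It makes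
    \<open>z\<close> start at \<open>ln 2\<close> and produces the additive \<open>ln 2\<close> in
    its recursion.\<close>
  define z where "z n i = ln (2 * real (?c n (Suc i)))" for n i
  have z_Suc: "z (Suc n) i = ln 2 + (\<Sum>j<m. real (M i j) * z n j)" if i: "i < m" for n i
  proof -
    define q where "q s = ln (real (state_weight s * ?c n s))" for s
    have q: "q 0 = 0" "q (Suc j) = z n j" for j
      by (simp_all add: q_def z_def c0 state_weight_def)
    have pos: "0 < real (state_weight s * ?c n s)" for s
      using c1[of n s] by (simp add: state_weight_def)
    have "z (Suc n) i = ln (2 * (\<Prod>e<d. real (state_weight (g i e) * ?c n (g i e))))"
      by (simp add: z_def GS[OF i])
    also have "\<dots> = ln 2 + ln (\<Prod>e<d. real (state_weight (g i e) * ?c n (g i e)))"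
      by (intro ln_mult_pos prod_pos pos) simp
    also have "ln (\<Prod>e<d. real (state_weight (g i e) * ?c n (g i e))) = (\<Sum>e<d. q (g i e))"
      unfolding q_def by (intro ln_prod less_imp_neq[THEN not_sym] pos finite_lessThan)
    also have "\<dots> = (\<Sum>s\<in>Suc ` {..<m}. real (card {e \<in> {..<d}. g i e = s}) * q s)"
    proof (rule sum_card_fibres[symmetric])
      fix e assume "g i e \<notin> Suc ` {..<m}"
      then have "g i e = 0" using g(1)[OF i, of e] by (cases "g i e") auto
      then show "q (g i e) = 0" by (simp add: q)
    qed auto
    also have "\<dots> = (\<Sum>j<m. real (M i j) * z n j)"
      by (subst sum.reindex) (auto simp: q g(2)[OF i, simplified])
    finally show ?thesis .
  qed
  define W where "W = (\<Sum>i<m. w i)"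
  have wW: "w i \<le> W" if "i < m" for i
    unfolding W_def using that w by (intro member_le_sum) (auto simp: less_imp_le)
  have W: "0 < W" using wW[OF m] w[OF m] by linarith
  \<comment> \<open>Chosen so that \<open>c * w i\<close> is at most the initial value
    \<open>ln 2\<close>.\<close>
  define c where "c = ln 2 / W"
  have c: "0 < c" using W by (simp add: c_def)
  have lower: "c * r ^ n * w i \<le> z n i" if "i < m" for n i
    using that
  proof (induction n arbitrary: i)
    case 0
    have "c * w i \<le> c * W" using wW[OF 0] c by (intro mult_left_mono) auto
    then show ?case using W by (simp add: z_def c_def)
  next
    case (Suc n)
    have "c * r ^ Suc n * w i = c * r ^ n * (r * w i)" by simp
    also have "\<dots> = (\<Sum>j<m. real (M i j) * (c * r ^ n * w j))"
      by (simp add: Mw[OF Suc.prems, symmetric] sum_distrib_left mult_ac)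
    also have "\<dots> \<le> (\<Sum>j<m. real (M i j) * z n j)"
      using Suc.IH by (intro sum_mono mult_left_mono) auto
    also have "\<dots> \<le> z (Suc n) i" by (simp add: z_Suc[OF Suc.prems])
    finally show ?case .
  qed
  define K where "K = (\<Sum>i<m. ln 2 / w i)"
  have Kw: "ln 2 \<le> K * w i" if "i < m" for i
  proof -
    have "ln 2 / w i \<le> K"
      unfolding K_def using that w by (intro member_le_sum[of i "{..<m}" "\<lambda>i. ln 2 / w i"]) (auto simp: less_imp_le)
    then show ?thesis using w[OF that] by (simp add: pos_divide_le_eq)
  qed
  have K0: "0 \<le> K" unfolding K_def using w by (intro sum_nonneg) (auto simp: less_imp_le)
  \<comment> \<open>Each level adds \<open>ln 2\<close>, at most \<open>K * r ^ n * w i\<close>,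
    which accounts for the linear factor; for \<open>r = 1\<close> such growth really
    occurs.\<close>
  have upper: "z n i \<le> K * real (Suc n) * r ^ n * w i" if "i < m" for n i
    using that
  proof (induction n arbitrary: i)
    case 0
    then show ?case using Kw by (simp add: z_def)
  next
    case (Suc n)
    have "(\<Sum>j<m. real (M i j) * z n j) \<le> (\<Sum>j<m. real (M i j) * (K * real (Suc n) * r ^ n * w j))"
      using Suc.IH by (intro sum_mono mult_left_mono) auto
    also have "\<dots> = K * real (Suc n) * r ^ n * (\<Sum>j<m. real (M i j) * w j)"
      by (simp add: sum_distrib_left mult_ac)
    also have "\<dots> = K * real (Suc n) * r ^ Suc n * w i" by (simp add: Mw[OF Suc.prems])
    finally have "z (Suc n) i \<le> ln 2 + K * real (Suc n) * r ^ Suc n * w i"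
      by (simp add: z_Suc[OF Suc.prems])
    moreover have "K * w i * 1 \<le> K * w i * r ^ Suc n"
      using K0 w[OF Suc.prems] one_le_power[OF r, of "Suc n"] by (intro mult_left_mono) auto
    then have "ln 2 \<le> K * 1 * r ^ Suc n * w i" using Kw[OF Suc.prems] by (simp add: mult_ac)
    moreover have "real (Suc (Suc n)) = real (Suc n) + 1" by simp
    ultimately show ?case by (simp only: distrib_left distrib_right)
  qed
  define t where "t n = card (blocks_of d A n X)" for n
  have t: "t (Suc n) = (\<Sum>a\<in>A. ?c n (letter_state a))" for n
    unfolding t_def by (rule card_blocks)
  have t_lower: "2 * ?c n (Suc 0) \<le> t (Suc n)" for n
  proof -
    have "(\<Sum>a\<in>{1, 2}. ?c n (letter_state a)) \<le> t (Suc n)"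
      unfolding t using m by (intro sum_mono2) auto
    then show ?thesis by (simp add: letter_state_def)
  qed
  have t2: "2 \<le> t (Suc n)" for n using t_lower[of n] c1[of n "Suc 0"] by linarith
  define K' where "K' = ln (real (Suc (2 * m))) + K * W"
  have K': "0 < K'"
    unfolding K'_def using m K0 W by (intro add_pos_nonneg) auto
  have ln_t_lower: "c * w 0 * r ^ n \<le> ln (real (t (Suc n)))" for n
  proof -
    have "c * w 0 * r ^ n \<le> z n 0" using lower[OF m, of n] by (simp add: mult_ac)
    also have "\<dots> \<le> ln (real (t (Suc n)))"
      unfolding z_def using t_lower[of n] c1[of n "Suc 0"] by (intro ln_mono) (simp_all flip: of_nat_mult)
    finally show ?thesis .
  qed
  have ln_t_upper: "ln (real (t (Suc n))) \<le> K' * real (Suc n) * r ^ n" for n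
  proof -
    define b where "b = K * real (Suc n) * r ^ n * W"
    have b0: "0 \<le> b" using K0 W r by (simp add: b_def)
    have "real (?c n (letter_state a)) \<le> exp b" if a: "a \<in> A" for a
    proof (cases "letter_state a")
      case 0
      then show ?thesis using b0 by (simp add: c0)
    next
      case (Suc i)
      then have i: "i < m" using letter_state_le[of a m] a by simp
      have "z n i \<le> K * real (Suc n) * r ^ n * w i" by (rule upper[OF i])
      also have "\<dots> \<le> b" unfolding b_def using wW[OF i] K0 r by (intro mult_left_mono) auto
      finally have "exp (z n i) \<le> exp b" by simp
      then show ?thesis using c1[of n "Suc i"] by (simp add: z_def Suc)
    qed
    then have "real (t (Suc n)) \<le> (\<Sum>a\<in>A. exp b)"
      unfolding t of_nat_sum by (intro sum_mono) auto
    also have "\<dots> = exp (ln (real (Suc (2 * m))) + b)" by (simp add: exp_add)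
    finally have "ln (real (t (Suc n))) \<le> ln (exp (ln (real (Suc (2 * m))) + b))"
      using t2[of n] by (intro ln_mono) auto
    then have "ln (real (t (Suc n))) \<le> ln (real (Suc (2 * m))) + b" by simp
    moreover have "1 * 1 \<le> real (Suc n) * r ^ n" using r by (intro mult_mono) auto
    then have "ln (real (Suc (2 * m))) * 1 \<le> ln (real (Suc (2 * m))) * (real (Suc n) * r ^ n)"
      by (intro mult_left_mono) auto
    ultimately show ?thesis by (simp add: K'_def b_def algebra_simps)
  qed
  have cw: "0 < c * w 0" using c w[OF m] by simp
  have lim: "(\<lambda>n. ln (ln (real (t (Suc n)))) / real (Suc n)) \<longlonglongrightarrow> ln r"
  proof (rule tendsto_sandwich)
    have pos: "0 < ln (real (t (Suc n)))" for n using t2[of n] by simp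
    have eq: "ln r + (C - ln r) / real (Suc n) = (C + real n * ln r) / real (Suc n)" for C n
      by (simp add: field_simps)
    have "ln (c * w 0) + real n * ln r \<le> ln (ln (real (t (Suc n))))" for n
    proof -
      have "ln (c * w 0) + real n * ln r = ln (c * w 0 * r ^ n)"
        using cw r by (simp add: ln_mult_pos ln_realpow)
      also have "\<dots> \<le> ln (ln (real (t (Suc n))))" using ln_t_lower[of n] cw r by (intro ln_mono) auto
      finally show ?thesis .
    qed
    then have "ln r + (ln (c * w 0) - ln r) / real (Suc n) \<le> ln (ln (real (t (Suc n)))) / real (Suc n)" for n
      unfolding eq by (intro divide_right_mono) auto
    then show "\<forall>\<^sub>F n in sequentially. ln r + (ln (c * w 0) - ln r) / real (Suc n)
        \<le> ln (ln (real (t (Suc n)))) / real (Suc n)" by simp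
    have "ln (ln (real (t (Suc n)))) \<le> ln K' + ln (real (Suc n)) + real n * ln r" for n
    proof -
      have "ln (ln (real (t (Suc n)))) \<le> ln (K' * real (Suc n) * r ^ n)"
        using ln_t_upper[of n] pos by (intro ln_mono) auto
      also have "\<dots> = ln K' + ln (real (Suc n)) + real n * ln r"
        using K' r by (simp add: ln_mult_pos ln_realpow del: of_nat_Suc)
      finally show ?thesis .
    qed
    then have "ln (ln (real (t (Suc n)))) / real (Suc n)
        \<le> ln r + (ln K' - ln r) / real (Suc n) + ln (real (Suc n)) / real (Suc n)" for n
      unfolding eq add_divide_distrib[symmetric] by (intro divide_right_mono) (simp_all add: ac_simps)
    then show "\<forall>\<^sub>F n in sequentially. ln (ln (real (t (Suc n)))) / real (Suc n)
        \<le> ln r + (ln K' - ln r) / real (Suc n) + ln (real (Suc n)) / real (Suc n)" by simp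
    have "(\<lambda>n. ln r + (ln (c * w 0) - ln r) / real (Suc n)) \<longlonglongrightarrow> ln r + 0"
      by (intro tendsto_add tendsto_const LIMSEQ_Suc[OF lim_const_over_n])
    then show "(\<lambda>n. ln r + (ln (c * w 0) - ln r) / real (Suc n)) \<longlonglongrightarrow> ln r" by simp
    have "(\<lambda>n. ln r + (ln K' - ln r) / real (Suc n) + ln (real (Suc n)) / real (Suc n)) \<longlonglongrightarrow> ln r + 0 + 0"
      by (intro tendsto_add tendsto_const LIMSEQ_Suc[OF lim_const_over_n] LIMSEQ_Suc[OF lim_ln_over_n])
    then show "(\<lambda>n. ln r + (ln K' - ln r) / real (Suc n) + ln (real (Suc n)) / real (Suc n)) \<longlonglongrightarrow> ln r"
      by simp
  qed
  have "has_entropy d A X (ln r)"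
    unfolding has_entropy_def t_def[symmetric]
  proof
    show "\<forall>\<^sub>F n in sequentially. 2 \<le> t n"
      using eventually_gt_at_top[of 0]
    proof eventually_elim
      case (elim n)
      then show ?case using t2[of "n - 1"] by simp
    qed
    show "(\<lambda>n. ln (ln (real (t n))) / real n) \<longlonglongrightarrow> ln r"
      by (rule LIMSEQ_imp_Suc[OF lim])
  qed
  moreover have "finite F"
    unfolding state_patterns_def
    by (rule finite_imageI, rule finite_subset[of _ "A \<times> A \<times> {..<d}"]) auto
  then have "tree_SFT d A X" using F unfolding tree_SFT_def by blast
  moreover have "1 \<le> d" by (simp add: d_def)
  ultimately show ?thesis unfolding tree_SFT_entropies_def using finA by blast
qed

lemma positive_eigenvalue_1: "positive_eigenvalue 1"
  by (rule positive_eigenvalueI[of "{0::nat}" "\<lambda>_. 1" "\<lambda>_ _. 1"]) auto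

theorem theorem1p1:
  shows "tree_SFT_entropies = {1 / real p * ln l | p l. perron l \<and> p \<ge> 1}"
proof (intro equalityI subsetI)
  fix h assume "h \<in> tree_SFT_entropies"
  then obtain d and A :: "nat set" and X where "finite A" "tree_SFT d A X" "has_entropy d A X h"
    by (auto simp: tree_SFT_entropies_def)
  then have "h = 0 \<or> 0 < h \<and> positive_eigenvalue (exp h)" using entropy_cases by blast
  \<comment> \<open>For \<open>h = 0\<close> the eigenvalue is \<open>exp 0 = 1\<close>.\<close>
  then have h: "positive_eigenvalue (exp h)" "1 \<le> exp h" using positive_eigenvalue_1 by auto
  then obtain p where p: "p \<ge> 1" "perron (exp h ^ p)" using positive_eigenvalue_imp_perron by blast
  then have "h = 1 / real p * ln (exp h ^ p)" by (simp add: ln_realpow)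
  then show "h \<in> {1 / real p * ln l | p l. perron l \<and> p \<ge> 1}" using p by blast
next
  fix h assume "h \<in> {1 / real p * ln l | p l. perron l \<and> p \<ge> 1}"
  then obtain p l where pl: "p \<ge> 1" "perron l" "h = 1 / real p * ln l" by blast
  have l: "1 \<le> l" using pl(2) by (simp add: perron_def)
  have r: "1 \<le> root p l" "root p l ^ p = l" using pl(1) l by (simp_all add: real_root_ge_1_iff)
  then have "positive_eigenvalue (root p l)"
    using positive_eigenvalue_root[OF perron_imp_positive_eigenvalue[OF pl(2)] _ pl(1), of "root p l"] l by simp
  then have "ln (root p l) \<in> tree_SFT_entropies" using r(1) by (rule positive_eigenvalue_imp_entropy)
  moreover have "h = ln (root p l)" using pl l by (simp add: ln_root)
  ultimately show "h \<in> tree_SFT_entropies" by simp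
qed

end
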